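(* Let $G$ be a finite $r$-group for some prime $r$, with $|G|>2$. Then $G$ is a $CD1$-group if and only if $r=2$ and $G$ is a $2$-group of central type with $|Z(G)|=2$.
   Context: A finite group $G$ is a $CD1$-group if $|G|>2$ and two columns of its complex character table differ by exactly one entry, i.e. there are non-conjugate $a,b\in G$ and a $\chi\in\mathrm{Irr}(G)$ with $\chi(a)\ne\chi(b)$ and $\psi(a)=\psi(b)$ for all $\psi\in\mathrm{Irr}(G)\setminus\{\chi\}$. A group $G$ is of central type if there is $\chi\in\mathrm{Irr}(G)$ with $[G:Z(G)]=\chi(1)^2$. Here $\mathrm{Irr}(G)$ is the set of complex irreducible characters of $G$. *)

theory Defs
  imports
    "HOL-Algebra.Algebra"
    "HOL-Computational_Algebra.Primes"
    "Jordan_Normal_Form.VS_Connect"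
begin

text \<open>
  Matrix representations of degree \<open>n\<close>: homomorphisms from \<open>G\<close> into the unit group of the ring
  of complex \<open>n\<close>-by-\<open>n\<close> matrices.
\<close>

definition is_rep :: "('a, 'b) monoid_scheme \<Rightarrow> nat \<Rightarrow> ('a \<Rightarrow> complex mat) \<Rightarrow> bool" where
  "is_rep G n \<rho> \<longleftrightarrow> \<rho> \<in> hom G (units_of (ring_mat TYPE(complex) n ()))"

definition is_irrep :: "('a, 'b) monoid_scheme \<Rightarrow> nat \<Rightarrow> ('a \<Rightarrow> complex mat) \<Rightarrow> bool" where
  "is_irrep G n \<rho> \<longleftrightarrow>
     is_rep G n \<rho> \<and> 0 < n \<and>
     (\<forall>W. VectorSpace.subspace class_ring W (module_vec TYPE(complex) n) \<longrightarrow>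
          (\<forall>g\<in>carrier G. \<forall>w\<in>W. \<rho> g *\<^sub>v w \<in> W) \<longrightarrow>
          W = {0\<^sub>v n} \<or> W = carrier_vec n)"

definition mat_trace :: "'c::comm_monoid_add mat \<Rightarrow> 'c" where
  "mat_trace A = (\<Sum>i<dim_row A. A $$ (i, i))"

text \<open>
  Characters are made extensional (\<open>undefined\<close> outside the carrier), so that two elements of
  \<open>Irr G\<close> are equal exactly when they agree on the elements of \<open>G\<close>.
\<close>

definition Irr :: "('a, 'b) monoid_scheme \<Rightarrow> ('a \<Rightarrow> complex) set" where
  "Irr G = {\<chi>. \<exists>n \<rho>. is_irrep G n \<rho> \<and> \<chi> = (\<lambda>g\<in>carrier G. mat_trace (\<rho> g))}"

definition conjugate_in :: "('a, 'b) monoid_scheme \<Rightarrow> 'a \<Rightarrow> 'a \<Rightarrow> bool" where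
  "conjugate_in G a b \<longleftrightarrow> (\<exists>g\<in>carrier G. b = g \<otimes>\<^bsub>G\<^esub> a \<otimes>\<^bsub>G\<^esub> inv\<^bsub>G\<^esub> g)"

definition group_center :: "('a, 'b) monoid_scheme \<Rightarrow> 'a set" where
  "group_center G = {z \<in> carrier G. \<forall>g\<in>carrier G. z \<otimes>\<^bsub>G\<^esub> g = g \<otimes>\<^bsub>G\<^esub> z}"

definition CD1_group :: "('a, 'b) monoid_scheme \<Rightarrow> bool" where
  "CD1_group G \<longleftrightarrow>
     group G \<and> finite (carrier G) \<and> 2 < Coset.order G \<and>
     (\<exists>a\<in>carrier G. \<exists>b\<in>carrier G. \<not> conjugate_in G a b \<and>
        (\<exists>\<chi>\<in>Irr G. \<chi> a \<noteq> \<chi> b \<and> (\<forall>\<psi>\<in>Irr G - {\<chi>}. \<psi> a = \<psi> b)))"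

definition central_type :: "('a, 'b) monoid_scheme \<Rightarrow> bool" where
  "central_type G \<longleftrightarrow>
     group G \<and> finite (carrier G) \<and>
     (\<exists>\<chi>\<in>Irr G. of_nat (card (rcosets\<^bsub>G\<^esub> (group_center G))) = (\<chi> \<one>\<^bsub>G\<^esub>)\<^sup>2)"

definition finite_p_group :: "nat \<Rightarrow> ('a, 'b) monoid_scheme \<Rightarrow> bool" where
  "finite_p_group p G \<longleftrightarrow>
     Factorial_Ring.prime p \<and> group G \<and> finite (carrier G) \<and> (\<exists>k. Coset.order G = p ^ k)"

end

theory Submission
  imports Defs "Jordan_Normal_Form.DL_Rank" "Jordan_Normal_Form.Spectral_Radius"
begin

text \<open>
  Let \<open>a\<close>, \<open>b\<close> be non-conjugate and let \<open>\<chi>\<close> be the only irreducible character with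
  \<open>\<chi> a \<noteq> \<chi> b\<close>. Write \<open>N\<^sub>a x\<close> for the number of \<open>g\<close> with \<open>g a g\<^sup>-\<^sup>1 = x\<close>. The class function
  \<open>N\<^sub>a - N\<^sub>b\<close> pairs with a character \<open>\<psi>\<close> to \<open>|G| (\<psi> a - \<psi> b)\<close>, so it is orthogonal to every
  irreducible character except \<open>\<chi>\<close>. As only the zero class function is orthogonal to all irreducible
  characters, \<open>N\<^sub>a x - N\<^sub>b x = (\<chi> a - \<chi> b) \<chi> (x\<^sup>-\<^sup>1)\<close> for all \<open>x\<close>
  (lemma \<open>columns_differing_in_one_character\<close>). In particular \<open>\<chi>\<close> vanishes outside two
  classes; since it does not vanish at the identity, one of \<open>a\<close>, \<open>b\<close> is the identity, say \<open>a\<close>.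

  Let \<open>n = \<chi> 1\<close> and let \<open>s\<close> be the order of the centralizer of \<open>b\<close>. The values of the formula at
  \<open>1\<close> and \<open>b\<close>, together with the fact that \<open>\<chi> (b\<^sup>-\<^sup>1)\<close> is the complex conjugate of \<open>\<chi> b\<close>, give
  \<open>|G|\<^sup>2 = n\<^sup>2 (|G| + s)\<close>. In an \<open>r\<close>-group \<open>|G|\<close>, \<open>s\<close> and hence \<open>|G| + s\<close> are powers of \<open>r\<close>, which
  forces \<open>s = |G|\<close> and \<open>r = 2\<close>. So \<open>b\<close> is central and \<open>|G| = 2 n\<^sup>2\<close>. An irreducible
  character has no zeros on the center, and the only non-zeros of \<open>\<chi>\<close> are \<open>1\<close> and \<open>b\<^sup>-\<^sup>1\<close>; hence
  the center has exactly these two elements (lemma \<open>central_type_of_conj_count\<close>).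

  Conversely let the center be \<open>{1, z}\<close> and \<open>|G| = 2 \<chi>(1)\<^sup>2\<close>. On the center \<open>|\<chi>|\<close> is
  \<open>\<chi> 1\<close>, so the two central elements exhaust the norm \<open>\<Sum>|\<chi>|\<^sup>2 = |G|\<close> and \<open>\<chi>\<close> vanishes
  elsewhere. Orthogonality of \<open>\<chi>\<close> to another \<open>\<psi>\<close> is then a statement about \<open>1\<close> and \<open>z\<close> only:
  with the trivial character it gives \<open>\<chi> z = - \<chi> 1\<close>, and with any \<open>\<psi>\<close> it then gives
  \<open>\<psi> z = \<psi> 1\<close>. So the columns of \<open>1\<close> and \<open>z\<close> differ exactly at \<open>\<chi>\<close>
  (lemma \<open>central_type_imp_CD1\<close>).

  The character theory behind this is built from matrices. Schur's lemma and averaging over the group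
  give the orthogonality relation in the bilinear form \<open>\<Sum> \<chi> g \<psi> (g\<^sup>-\<^sup>1)\<close>; an invariant positive
  definite Hermitian form gives \<open>\<chi> (g\<^sup>-\<^sup>1) = cnj (\<chi> g)\<close>; and completeness of the irreducible characters comes
  from the regular representation, in which a class function acts by a normal matrix
  (lemma \<open>class_function_orthogonal_to_irreps_eq_zero\<close>).
\<close>

section \<open>Sums and traces of matrices\<close>

text \<open>
  Matrices of all dimensions share one type, so the dimensions have to be given: an empty sum would
  not determine them.
\<close>

definition mat_sum :: "nat \<Rightarrow> nat \<Rightarrow> ('i \<Rightarrow> 'c::comm_ring_1 mat) \<Rightarrow> 'i set \<Rightarrow> 'c mat" where
  "mat_sum n m F S = mat n m (\<lambda>(i, j). \<Sum>x\<in>S. F x $$ (i, j))"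

lemma mat_sum_carrier [simp]: "mat_sum n m F S \<in> carrier_mat n m"
  and mat_sum_dim [simp]: "dim_row (mat_sum n m F S) = n" "dim_col (mat_sum n m F S) = m"
  by (auto simp: mat_sum_def)

lemma mat_sum_index [simp]:
  "i < n \<Longrightarrow> j < m \<Longrightarrow> mat_sum n m F S $$ (i, j) = (\<Sum>x\<in>S. F x $$ (i, j))"
  by (simp add: mat_sum_def)

lemma mat_sum_cong:
  assumes "\<And>x. x \<in> S \<Longrightarrow> F x = H x"
  shows "mat_sum n m F S = mat_sum n m H S"
  by (rule eq_matI) (auto simp: assms)

lemma mat_sum_reindex:
  assumes "bij_betw h S' S"
  shows "mat_sum n m F S = mat_sum n m (\<lambda>x. F (h x)) S'"
  by (rule eq_matI) (auto simp: sum.reindex_bij_betw[OF assms, symmetric])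

lemma mat_mult_index:
  assumes "A \<in> carrier_mat k n" "B \<in> carrier_mat n m" "i < k" "j < m"
  shows "(A * B) $$ (i, j) = (\<Sum>l<n. A $$ (i, l) * B $$ (l, j))"
  using assms by (auto simp: scalar_prod_def lessThan_atLeast0 intro!: sum.cong)

lemma mat_mult_mat_sum:
  assumes A: "A \<in> carrier_mat k n" and F: "\<And>x. x \<in> S \<Longrightarrow> F x \<in> carrier_mat n m"
  shows "A * mat_sum n m F S = mat_sum k m (\<lambda>x. A * F x) S"
proof (rule eq_matI)
  fix i j assume "i < dim_row (mat_sum k m (\<lambda>x. A * F x) S)" "j < dim_col (mat_sum k m (\<lambda>x. A * F x) S)"
  then have ij: "i < k" "j < m" by auto
  have "(A * mat_sum n m F S) $$ (i, j) = (\<Sum>l<n. \<Sum>x\<in>S. A $$ (i, l) * F x $$ (l, j))"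
    using ij by (simp add: mat_mult_index[OF A mat_sum_carrier] sum_distrib_left)
  also have "\<dots> = (\<Sum>x\<in>S. \<Sum>l<n. A $$ (i, l) * F x $$ (l, j))" by (rule sum.swap)
  also have "\<dots> = (\<Sum>x\<in>S. (A * F x) $$ (i, j))"
    by (intro sum.cong refl) (simp add: mat_mult_index[OF A F ij])
  finally show "(A * mat_sum n m F S) $$ (i, j) = mat_sum k m (\<lambda>x. A * F x) S $$ (i, j)"
    using ij by simp
qed (use A in auto)

lemma mat_sum_mat_mult:
  assumes A: "A \<in> carrier_mat m k" and F: "\<And>x. x \<in> S \<Longrightarrow> F x \<in> carrier_mat n m"
  shows "mat_sum n m F S * A = mat_sum n k (\<lambda>x. F x * A) S"
proof (rule eq_matI)
  fix i j assume "i < dim_row (mat_sum n k (\<lambda>x. F x * A) S)" "j < dim_col (mat_sum n k (\<lambda>x. F x * A) S)"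
  then have ij: "i < n" "j < k" by auto
  have "(mat_sum n m F S * A) $$ (i, j) = (\<Sum>l<m. \<Sum>x\<in>S. F x $$ (i, l) * A $$ (l, j))"
    using ij by (simp add: mat_mult_index[OF mat_sum_carrier A] sum_distrib_right)
  also have "\<dots> = (\<Sum>x\<in>S. \<Sum>l<m. F x $$ (i, l) * A $$ (l, j))" by (rule sum.swap)
  also have "\<dots> = (\<Sum>x\<in>S. (F x * A) $$ (i, j))"
    by (intro sum.cong refl) (simp add: mat_mult_index[OF F A ij])
  finally show "(mat_sum n m F S * A) $$ (i, j) = mat_sum n k (\<lambda>x. F x * A) S $$ (i, j)"
    using ij by simp
qed (use A in auto)

lemma mat_trace_mat_sum:
  assumes "\<And>x. x \<in> S \<Longrightarrow> F x \<in> carrier_mat n n"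
  shows "mat_trace (mat_sum n n F S) = (\<Sum>x\<in>S. mat_trace (F x))"
proof -
  have "mat_trace (mat_sum n n F S) = (\<Sum>x\<in>S. \<Sum>i<n. F x $$ (i, i))"
    unfolding mat_trace_def by (simp add: sum.swap[of _ S])
  also have "\<dots> = (\<Sum>x\<in>S. mat_trace (F x))"
    by (intro sum.cong refl) (use assms in \<open>auto simp: mat_trace_def\<close>)
  finally show ?thesis .
qed

lemma mat_trace_mult_comm:
  fixes A B :: "'c::comm_ring_1 mat"
  assumes "A \<in> carrier_mat n m" "B \<in> carrier_mat m n"
  shows "mat_trace (A * B) = mat_trace (B * A)"
proof -
  have "mat_trace (A * B) = (\<Sum>i<n. \<Sum>l<m. A $$ (i, l) * B $$ (l, i))"
    unfolding mat_trace_def using assms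
    by (intro sum.cong) (auto simp: mat_mult_index[OF assms] simp del: index_mult_mat(1))
  also have "\<dots> = (\<Sum>l<m. \<Sum>i<n. B $$ (l, i) * A $$ (i, l))"
    by (subst sum.swap) (simp add: mult.commute)
  also have "\<dots> = mat_trace (B * A)"
    unfolding mat_trace_def using assms
    by (intro sum.cong) (auto simp: mat_mult_index[OF assms(2,1)] simp del: index_mult_mat(1))
  finally show ?thesis .
qed

lemma mat_trace_smult_one: "mat_trace (c \<cdot>\<^sub>m 1\<^sub>m n) = c * of_nat n" for c :: "'c::comm_ring_1"
  by (simp add: mat_trace_def)

definition elem_mat :: "nat \<Rightarrow> nat \<Rightarrow> nat \<Rightarrow> nat \<Rightarrow> complex mat" where
  "elem_mat n m i j = mat n m (\<lambda>(a, b). if a = i \<and> b = j then 1 else 0)"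

lemma elem_mat_carrier [simp]: "elem_mat n m i j \<in> carrier_mat n m"
  by (simp add: elem_mat_def)

text \<open>
  Matrix units isolate products of diagonal entries; summing over \<open>i\<close> and \<open>j\<close> turns these into
  products of traces.
\<close>

lemma elem_mat_sandwich:
  assumes A: "A \<in> carrier_mat n n" and B: "B \<in> carrier_mat m m" and ij: "i < n" "j < m"
  shows "(A * elem_mat n m i j * B) $$ (i, j) = A $$ (i, i) * B $$ (j, j)"
proof -
  have e: "(A * elem_mat n m i j) $$ (i, l) = (if l = j then A $$ (i, i) else 0)" if l: "l < m" for l
  proof -
    have "(A * elem_mat n m i j) $$ (i, l) = (\<Sum>k<n. if k = i then A $$ (i, k) * (if l = j then 1 else 0) else 0)"
      unfolding mat_mult_index[OF A elem_mat_carrier ij(1) l]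
      by (intro sum.cong refl) (use l in \<open>auto simp: elem_mat_def\<close>)
    then show ?thesis using ij by simp
  qed
  have "(A * elem_mat n m i j * B) $$ (i, j) = (\<Sum>l<m. (A * elem_mat n m i j) $$ (i, l) * B $$ (l, j))"
    by (rule mat_mult_index[OF _ B ij]) (use A in auto)
  also have "\<dots> = (\<Sum>l<m. if l = j then A $$ (i, i) * B $$ (l, j) else 0)"
    by (intro sum.cong refl) (simp add: e)
  finally show ?thesis using ij by simp
qed

section \<open>Injective matrices and subspaces\<close>

definition inj_mat :: "'c::comm_ring_1 mat \<Rightarrow> bool" where
  "inj_mat A \<longleftrightarrow> (\<forall>v\<in>carrier_vec (dim_col A). A *\<^sub>v v = 0\<^sub>v (dim_row A) \<longrightarrow> v = 0\<^sub>v (dim_col A))"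

lemma inj_matD:
  assumes "inj_mat A" "A \<in> carrier_mat n m" "v \<in> carrier_vec m" "A *\<^sub>v v = 0\<^sub>v n"
  shows "v = 0\<^sub>v m"
  using assms unfolding inj_mat_def by auto

lemma mat_eq_zeroI:
  fixes A :: "'c::comm_ring_1 mat"
  assumes A: "A \<in> carrier_mat n m" and z: "\<And>v. v \<in> carrier_vec m \<Longrightarrow> A *\<^sub>v v = 0\<^sub>v n"
  shows "A = 0\<^sub>m n m"
proof (rule eq_matI)
  fix i j assume "i < dim_row (0\<^sub>m n m)" "j < dim_col (0\<^sub>m n m)"
  then have ij: "i < n" "j < m" by auto
  have "A $$ (i, j) = (A *\<^sub>v unit_vec m j) $ i" using A ij by auto
  then show "A $$ (i, j) = 0\<^sub>m n m $$ (i, j)" using z[of "unit_vec m j"] ij by auto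
qed (use A in auto)

lemma inj_mat_mult_eq_zero:
  assumes P: "inj_mat P" "P \<in> carrier_mat n m" and Y: "Y \<in> carrier_mat m k"
    and eq: "P * Y = 0\<^sub>m n k"
  shows "Y = 0\<^sub>m m k"
proof (rule mat_eq_zeroI[OF Y])
  fix v :: "'a vec" assume v: "v \<in> carrier_vec k"
  have "P *\<^sub>v (Y *\<^sub>v v) = (P * Y) *\<^sub>v v" using P(2) Y v by simp
  also have "\<dots> = 0\<^sub>v n" using v by (auto simp: eq)
  finally show "Y *\<^sub>v v = 0\<^sub>v m" using inj_matD[OF P] Y v by simp
qed

lemma inj_mat_cancel:
  fixes P :: "'c::comm_ring_1 mat"
  assumes P: "inj_mat P" "P \<in> carrier_mat n m" and Y: "Y \<in> carrier_mat m k" "Z \<in> carrier_mat m k"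
    and eq: "P * Y = P * Z"
  shows "Y = Z"
proof -
  have "P * (Y - Z) = P * Y - P * Z" using P Y by (intro mult_minus_distrib_mat)
  also have "\<dots> = 0\<^sub>m n k" using P Y by (auto simp: eq)
  finally have z0: "P * (Y - Z) = 0\<^sub>m n k" .
  have z: "Y - Z = 0\<^sub>m m k" using inj_mat_mult_eq_zero[OF P minus_carrier_mat[OF Y(2)] z0] .
  show ?thesis
  proof (rule eq_matI)
    fix i j assume "i < dim_row Z" "j < dim_col Z"
    then show "Y $$ (i, j) = Z $$ (i, j)" using arg_cong[OF z, of "\<lambda>M. M $$ (i, j)"] Y by auto
  qed (use Y in auto)
qed

lemma inj_mat_mult:
  fixes P :: "'c::comm_ring_1 mat"
  assumes "inj_mat P" "P \<in> carrier_mat n m" "inj_mat Q" "Q \<in> carrier_mat m k"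
  shows "inj_mat (P * Q)"
  unfolding inj_mat_def
proof (intro ballI impI)
  fix v assume v: "v \<in> carrier_vec (dim_col (P * Q))" and z: "(P * Q) *\<^sub>v v = 0\<^sub>v (dim_row (P * Q))"
  have v: "v \<in> carrier_vec k" using v assms by auto
  have "P *\<^sub>v (Q *\<^sub>v v) = 0\<^sub>v n" using z assms v by auto
  then have "Q *\<^sub>v v = 0\<^sub>v m" using inj_matD[OF assms(1,2)] assms(4) v by auto
  then show "v = 0\<^sub>v (dim_col (P * Q))" using inj_matD[OF assms(3,4)] assms v by auto
qed

lemma inj_mat_one: "inj_mat (1\<^sub>m n)"
  unfolding inj_mat_def by auto

lemma mult_mat_unit_vec:
  fixes A :: "'c::comm_ring_1 mat"
  assumes "A \<in> carrier_mat n m" "j < m"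
  shows "A *\<^sub>v unit_vec m j = col A j"
  by (rule eq_vecI) (use assms in auto)

text \<open>
  Solves \<open>A * Y = B\<close> column by column.
\<close>

lemma columns_in_image_factor:
  assumes "\<And>j. j < k \<Longrightarrow> \<exists>v\<in>carrier_vec m. A *\<^sub>v v = col B j"
    and A: "A \<in> carrier_mat n m" and B: "B \<in> carrier_mat n k"
  shows "\<exists>Y\<in>carrier_mat m k. A * Y = B"
proof -
  obtain f where f: "\<And>j. j < k \<Longrightarrow> f j \<in> carrier_vec m \<and> A *\<^sub>v f j = col B j"
    using assms(1) by metis
  define Y where "Y = mat_of_cols m (map f [0..<k])"
  have Y: "Y \<in> carrier_mat m k" unfolding Y_def by (auto intro: mat_of_cols_carrier)
  have cY: "col Y j = f j" if "j < k" for j unfolding Y_def using f[OF that] that by (auto simp: col_mat_of_cols)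
  have "A * Y = B"
  proof (rule mat_col_eqI)
    fix j assume "j < dim_col B"
    then have j: "j < k" using B by auto
    have "col (A * Y) j = A *\<^sub>v col Y j" using A Y j by (auto simp: col_mult2)
    then show "col (A * Y) j = col B j" using f[OF j] cY[OF j] by simp
  qed (use A B Y in auto)
  then show ?thesis using Y by blast
qed

text \<open>
  Bijectivity gives \<open>T\<close> a two-sided inverse \<open>S\<close>, so \<open>A = T * B * S\<close> and the trace is cyclic. That
  \<open>n = m\<close> never has to be shown.
\<close>

lemma mat_trace_eq_of_bijective_intertwiner:
  fixes A B T :: "'c::comm_ring_1 mat"
  assumes A: "A \<in> carrier_mat n n" and B: "B \<in> carrier_mat m m" and T: "T \<in> carrier_mat n m"
    and inj: "inj_mat T" and surj: "\<And>w. w \<in> carrier_vec n \<Longrightarrow> \<exists>v\<in>carrier_vec m. T *\<^sub>v v = w"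
    and eq: "A * T = T * B"
  shows "mat_trace A = mat_trace B"
proof -
  obtain S where S: "S \<in> carrier_mat m n" and TS: "T * S = 1\<^sub>m n"
    using columns_in_image_factor[OF surj T, of n "1\<^sub>m n"] by auto
  \<comment> \<open>The right inverse \<open>S\<close> is also a left inverse, because the injective \<open>T\<close> can be cancelled.\<close>
  have "T * (S * T) = (T * S) * T" using S T by simp
  also have "\<dots> = T * 1\<^sub>m m" using TS T by simp
  finally have ST: "S * T = 1\<^sub>m m"
    using inj_mat_cancel[OF inj T, of "S * T" m "1\<^sub>m m"] S T by simp
  have "mat_trace A = mat_trace (A * (T * S))" using A TS by simp
  also have "A * (T * S) = (A * T) * S" using assoc_mult_mat[OF A T S] by simp
  also have "\<dots> = T * (B * S)" unfolding eq using assoc_mult_mat[OF T B S] .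
  also have "mat_trace (T * (B * S)) = mat_trace ((B * S) * T)"
    using B S T by (intro mat_trace_mult_comm) auto
  also have "(B * S) * T = B" using B S T ST by simp
  finally show ?thesis .
qed

lemma inj_mat_square_surj:
  fixes A :: "'c::field mat"
  assumes A: "A \<in> carrier_mat n n" and inj: "inj_mat A" and w: "w \<in> carrier_vec n"
  shows "\<exists>v\<in>carrier_vec n. A *\<^sub>v v = w"
proof -
  have "det A \<noteq> 0" using det_0_iff_vec_prod_zero_field[OF A] inj_matD[OF inj A] by blast
  then have "A \<in> Units (ring_mat TYPE('c) n ())" by (rule det_non_zero_imp_unit[OF A])
  then obtain B where B: "B \<in> carrier_mat n n" "A * B = 1\<^sub>m n"
    unfolding Units_def by (auto simp: ring_mat_simps)
  have "A *\<^sub>v (B *\<^sub>v w) = w" using assoc_mult_mat_vec[OF A B(1) w] B w by simp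
  then show ?thesis using B w by (intro bexI[of _ "B *\<^sub>v w"]) auto
qed

lemma subspace_module_vec_iff:
  fixes W :: "'c::field vec set"
  shows "VectorSpace.subspace class_ring W (module_vec TYPE('c) n) \<longleftrightarrow>
    W \<subseteq> carrier_vec n \<and> 0\<^sub>v n \<in> W \<and> (\<forall>v\<in>W. \<forall>w\<in>W. v + w \<in> W) \<and> (\<forall>c. \<forall>v\<in>W. c \<cdot>\<^sub>v v \<in> W)"
  unfolding VectorSpace.subspace_def submodule_def
  using vec_vs[where 'a='c, of n] vec_module[where 'a='c, of n]
  by (auto simp: module_vec_simps)

lemma subspace_kernel:
  fixes A :: "'c::field mat"
  assumes A: "A \<in> carrier_mat n m"
  shows "VectorSpace.subspace class_ring {v \<in> carrier_vec m. A *\<^sub>v v = 0\<^sub>v n} (module_vec TYPE('c) m)"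
  unfolding subspace_module_vec_iff using A
  by (auto simp: mult_add_distrib_mat_vec mult_mat_vec)

lemma subspace_image:
  fixes A :: "'c::field mat"
  assumes A: "A \<in> carrier_mat n m"
  shows "VectorSpace.subspace class_ring ((\<lambda>v. A *\<^sub>v v) ` carrier_vec m) (module_vec TYPE('c) n)"
  unfolding subspace_module_vec_iff
proof (intro conjI ballI allI)
  show "0\<^sub>v n \<in> (\<lambda>v. A *\<^sub>v v) ` carrier_vec m"
    using A by (intro image_eqI[of _ _ "0\<^sub>v m"]) auto
next
  fix v w assume "v \<in> (\<lambda>v. A *\<^sub>v v) ` carrier_vec m" "w \<in> (\<lambda>v. A *\<^sub>v v) ` carrier_vec m"
  then show "v + w \<in> (\<lambda>v. A *\<^sub>v v) ` carrier_vec m"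
    using A by (auto simp flip: mult_add_distrib_mat_vec)
next
  fix c v assume "v \<in> (\<lambda>v. A *\<^sub>v v) ` carrier_vec m"
  then show "c \<cdot>\<^sub>v v \<in> (\<lambda>v. A *\<^sub>v v) ` carrier_vec m"
    using A by (auto simp flip: mult_mat_vec)
qed (use A in auto)

text \<open>
  The columns of \<open>P\<close> form a maximal linearly independent subset of \<open>W\<close>. Writing \<open>W\<close> as the image of
  an injective matrix turns the restriction of a representation to \<open>W\<close> into matrices again.
\<close>

lemma proper_subspace_as_image:
  fixes W :: "'c::field vec set"
  assumes W: "VectorSpace.subspace class_ring W (module_vec TYPE('c) n)"
    and nonzero: "W \<noteq> {0\<^sub>v n}" and proper: "W \<noteq> carrier_vec n"
  obtains m P where "0 < m" "m < n" "P \<in> carrier_mat n m" "inj_mat P"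
    "W = (\<lambda>v. P *\<^sub>v v) ` carrier_vec m"
proof -
  interpret vec_space "TYPE('c)" n .
  note Wsub = W[unfolded subspace_module_vec_iff]
  define Pr where "Pr = (\<lambda>S. S \<subseteq> W \<and> lin_indpt S)"
  have "\<exists>S. finite S \<and> maximal S Pr"
  proof (rule maximal_exists)
    fix S assume "Pr S"
    then show "finite S \<and> card S \<le> dim"
      using li_le_dim[OF fin_dim, of S] Wsub unfolding Pr_def by auto
  next
    show "Pr {}" unfolding Pr_def lin_dep_def by auto
  qed
  then obtain S where S: "finite S" "maximal S Pr" by blast
  have SW: "S \<subseteq> W" and li: "lin_indpt S" using S(2) unfolding maximal_def Pr_def by auto
  have Sc: "S \<subseteq> carrier_vec n" using SW Wsub by auto
  have WS: "W = span S"
  proof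
    show "span S \<subseteq> W"
      using span_is_subset[OF SW] W unfolding VectorSpace.subspace_def by blast
    show "W \<subseteq> span S"
    proof
      fix w assume w: "w \<in> W"
      show "w \<in> span S"
      proof (cases "w \<in> S")
        case True
        then show ?thesis using Sc span_mem by blast
      next
        case False
        have "lin_dep (S \<union> {w})"
        proof (rule ccontr)
          assume "\<not> lin_dep (S \<union> {w})"
          then have "Pr (S \<union> {w})" using SW w unfolding Pr_def by auto
          then have "S \<union> {w} = S" using S(2) unfolding maximal_def by blast
          then show False using False by auto
        qed
        then show ?thesis using lin_dep_iff_in_span[of S w] Sc li False w Wsub by auto
      qed
    qed
  qed
  obtain bs where bs: "set bs = S" "distinct bs" using finite_distinct_list[OF S(1)] by blast
  define P where "P = mat_of_cols n bs"
  define m where "m = length bs"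
  have P: "P \<in> carrier_mat n m" unfolding P_def m_def by simp
  have cols: "cols P = bs" unfolding P_def using Sc bs by (intro cols_mat_of_cols) auto
  have "inj_mat P"
    unfolding inj_mat_def using lin_depI[OF P] P li bs cols by auto
  moreover have "W = (\<lambda>v. P *\<^sub>v v) ` carrier_vec m"
  proof -
    have "W = col_space P" unfolding col_space_def cols bs(1) WS ..
    also have "\<dots> = (\<lambda>v. P *\<^sub>v v) ` carrier_vec m"
      using col_space_eq[OF P] P by auto
    finally show ?thesis .
  qed
  moreover have "0 < m"
  proof (rule ccontr)
    assume "\<not> 0 < m"
    then have "S = {}" using bs unfolding m_def by auto
    then show False using WS nonzero span_empty by simp
  qed
  moreover have "m < n"
  proof (rule ccontr)
    assume "\<not> m < n"
    then have "basis S" using dim_li_is_basis[OF fin_dim S(1)] Sc li bs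
      distinct_card[OF bs(2)] dim_is_n unfolding m_def by auto
    then show False using WS proper unfolding basis_def by simp
  qed
  ultimately show ?thesis using that P by blast
qed

section \<open>Adjoints of complex matrices\<close>

lemma mat_adjoint_carrier [simp]: "A \<in> carrier_mat n m \<Longrightarrow> mat_adjoint A \<in> carrier_mat m n"
  unfolding mat_adjoint_def by (auto intro!: mat_of_rows_carrier)

lemma mat_adjoint_dim [simp]:
  "dim_row (mat_adjoint A) = dim_col A" "dim_col (mat_adjoint A) = dim_row A"
  unfolding mat_adjoint_def by auto

lemma mat_adjoint_index:
  fixes A :: "complex mat"
  assumes "i < dim_col A" "j < dim_row A"
  shows "mat_adjoint A $$ (i, j) = cnj (A $$ (j, i))"
  unfolding mat_adjoint_def using assms by (simp add: mat_of_rows_index)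

lemma mat_adjoint_mult:
  fixes A B :: "complex mat"
  assumes A: "A \<in> carrier_mat n m" and B: "B \<in> carrier_mat m k"
  shows "mat_adjoint (A * B) = mat_adjoint B * mat_adjoint A"
proof (rule eq_matI)
  note adj = mat_adjoint_carrier[OF A] mat_adjoint_carrier[OF B]
  fix i j assume "i < dim_row (mat_adjoint B * mat_adjoint A)" "j < dim_col (mat_adjoint B * mat_adjoint A)"
  then have ij: "i < k" "j < n" using adj by auto
  have "mat_adjoint (A * B) $$ (i, j) = cnj ((A * B) $$ (j, i))"
    using A B ij by (intro mat_adjoint_index) auto
  also have "\<dots> = (\<Sum>l<m. mat_adjoint B $$ (i, l) * mat_adjoint A $$ (l, j))"
    using A B ij
    by (simp add: mat_mult_index[OF A B] mat_adjoint_index mult.commute del: index_mult_mat(1))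
  also have "\<dots> = (mat_adjoint B * mat_adjoint A) $$ (i, j)"
    using mat_mult_index[OF adj(2,1)] ij by simp
  finally show "mat_adjoint (A * B) $$ (i, j) = (mat_adjoint B * mat_adjoint A) $$ (i, j)" .
qed (use A B in auto)

lemma mat_adjoint_adjoint:
  fixes A :: "complex mat"
  shows "mat_adjoint (mat_adjoint A) = A"
  by (rule eq_matI) (auto simp: mat_adjoint_index)

lemma mat_trace_adjoint:
  fixes A :: "complex mat"
  assumes A: "A \<in> carrier_mat n n"
  shows "mat_trace (mat_adjoint A) = cnj (mat_trace A)"
proof -
  show ?thesis using A by (simp add: mat_trace_def mat_adjoint_index)
qed

lemma adjoint_mult_self_diagonal:
  fixes A :: "complex mat"
  assumes A: "A \<in> carrier_mat n m" and j: "j < m"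
  shows "(mat_adjoint A * A) $$ (j, j) = of_real (\<Sum>i<n. (cmod (A $$ (i, j)))\<^sup>2)"
proof -
  have "(mat_adjoint A * A) $$ (j, j) = (\<Sum>i<n. mat_adjoint A $$ (j, i) * A $$ (i, j))"
    using mat_mult_index[OF mat_adjoint_carrier[OF A] A] j by simp
  also have "\<dots> = of_real (\<Sum>i<n. (cmod (A $$ (i, j)))\<^sup>2)"
    unfolding of_real_sum using A j
    by (intro sum.cong refl) (simp add: mat_adjoint_index complex_norm_square del: of_real_power)
  finally show ?thesis .
qed

text \<open>
  The diagonal entries of \<open>A\<^sup>* A\<close> are the squared norms of the columns of \<open>A\<close>.
\<close>

lemma adjoint_mult_self_eq_zero:
  fixes A :: "complex mat"
  assumes A: "A \<in> carrier_mat n m" and z: "mat_adjoint A * A = 0\<^sub>m m m"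
  shows "A = 0\<^sub>m n m"
proof (rule eq_matI)
  fix i j assume "i < dim_row (0\<^sub>m n m)" "j < dim_col (0\<^sub>m n m)"
  then have ij: "i < n" "j < m" by auto
  have "complex_of_real (\<Sum>i<n. (cmod (A $$ (i, j)))\<^sup>2) = 0"
    using adjoint_mult_self_diagonal[OF A ij(2)] ij(2) unfolding z by (simp del: of_real_sum)
  then have "(\<Sum>i<n. (cmod (A $$ (i, j)))\<^sup>2) = 0" unfolding of_real_eq_0_iff .
  then have "(cmod (A $$ (i, j)))\<^sup>2 = 0"
    using ij(1) by (subst (asm) sum_nonneg_eq_0_iff) auto
  then show "A $$ (i, j) = 0\<^sub>m n m $$ (i, j)" using ij by simp
qed (use A in auto)

section \<open>A sum of two prime powers\<close>

text \<open>
  If \<open>i < k\<close>, then \<open>r ^ (i + 1)\<close> divides two of the three powers and hence also \<open>r ^ i\<close>, which is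
  absurd. So the sum is \<open>2 * r ^ k\<close>, and \<open>2\<close> is a power of \<open>r\<close>.
\<close>

lemma prime_power_sum_eq_prime_power:
  fixes r :: nat
  assumes r: "Factorial_Ring.prime r" and ik: "i \<le> k" and eq: "r ^ k + r ^ i = r ^ j"
  shows "i = k \<and> r = 2"
proof -
  have r1: "1 < r" using prime_gt_1_nat[OF r] .
  have pos: "0 < r ^ l" for l using r1 by simp
  have "r ^ k < r ^ j" using pos[of i] by (simp flip: eq)
  then have kj: "k < j" using r1 by (simp add: power_strict_increasing_iff)
  have "i = k"
  proof (rule ccontr)
    assume "i \<noteq> k"
    then have "Suc i \<le> k" "Suc i \<le> j" using ik kj by auto
    then have "r ^ Suc i dvd r ^ k" "r ^ Suc i dvd r ^ k + r ^ i" unfolding eq by (auto simp only: intro!: le_imp_power_dvd)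
    then have "r ^ Suc i dvd r ^ i" using dvd_add_right_iff by blast
    then have "r ^ Suc i \<le> r ^ i" using pos dvd_imp_le by blast
    then show False using r1 by simp
  qed
  moreover have "r = 2"
  proof -
    have "r ^ k * 2 = r ^ k * r ^ (j - k)" using eq \<open>i = k\<close> kj by (simp flip: power_add)
    then have "2 = r ^ (j - k)" using r1 by simp
    then have "r dvd 2" using dvd_power[of "j - k" r] kj by simp
    then have "r \<le> 2" by (auto dest: dvd_imp_le)
    then show ?thesis using r1 by simp
  qed
  ultimately show ?thesis by simp
qed

section \<open>Representations and Schur's lemma\<close>

locale finite_group = group G for G (structure) +
  assumes finite_carrier [simp]: "finite (carrier G)"
begin

lemma is_rep_iff:
  "is_rep G n \<rho> \<longleftrightarrow> (\<forall>g\<in>carrier G. \<rho> g \<in> carrier_mat n n) \<and> \<rho> \<one> = 1\<^sub>m n \<and>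
    (\<forall>g\<in>carrier G. \<forall>h\<in>carrier G. \<rho> (g \<otimes> h) = \<rho> g * \<rho> h)" (is "_ \<longleftrightarrow> ?R")
proof
  interpret M: ring "ring_mat TYPE(complex) n ()" by (rule ring_mat)
  interpret U: group "units_of (ring_mat TYPE(complex) n ())" by (rule M.units_group)
  {
    assume "is_rep G n \<rho>"
    then have hom: "\<rho> \<in> hom G (units_of (ring_mat TYPE(complex) n ()))" unfolding is_rep_def .
    have "\<rho> \<one> = \<one>\<^bsub>units_of (ring_mat TYPE(complex) n ())\<^esub>"
      using hom hom_one is_group U.is_group by blast
    then show ?R
      using hom unfolding hom_def units_of_def by (auto simp: ring_mat_simps Units_def Pi_def)
  next
    assume R: ?R
    have "\<rho> g \<in> Units (ring_mat TYPE(complex) n ())" if g: "g \<in> carrier G" for g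
    proof -
      have "\<rho> g * \<rho> (inv g) = 1\<^sub>m n" "\<rho> (inv g) * \<rho> g = 1\<^sub>m n"
        using R g by (metis inv_closed r_inv, metis inv_closed l_inv)
      then show ?thesis using R g unfolding Units_def by (auto simp: ring_mat_simps intro!: bexI[of _ "\<rho> (inv g)"])
    qed
    then show "is_rep G n \<rho>"
      using R unfolding is_rep_def hom_def units_of_def by (auto simp: ring_mat_simps)
  }
qed

lemma rep_carrier: "is_rep G n \<rho> \<Longrightarrow> g \<in> carrier G \<Longrightarrow> \<rho> g \<in> carrier_mat n n"
  and rep_one: "is_rep G n \<rho> \<Longrightarrow> \<rho> \<one> = 1\<^sub>m n"
  and rep_mult: "is_rep G n \<rho> \<Longrightarrow> g \<in> carrier G \<Longrightarrow> h \<in> carrier G \<Longrightarrow> \<rho> (g \<otimes> h) = \<rho> g * \<rho> h"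
  unfolding is_rep_iff by auto

lemma rep_inv:
  assumes "is_rep G n \<rho>" "g \<in> carrier G"
  shows "\<rho> g * \<rho> (inv g) = 1\<^sub>m n" "\<rho> (inv g) * \<rho> g = 1\<^sub>m n"
  using assms by (simp_all flip: rep_mult add: rep_one)

lemma irrep_rep: "is_irrep G n \<rho> \<Longrightarrow> is_rep G n \<rho>"
  and irrep_pos: "is_irrep G n \<rho> \<Longrightarrow> 0 < n"
  by (auto simp: is_irrep_def)

lemma irrepD:
  assumes "is_irrep G n \<rho>" "VectorSpace.subspace class_ring W (module_vec TYPE(complex) n)"
    and "\<And>g w. g \<in> carrier G \<Longrightarrow> w \<in> W \<Longrightarrow> \<rho> g *\<^sub>v w \<in> W"
  shows "W = {0\<^sub>v n} \<or> W = carrier_vec n"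
  using assms unfolding is_irrep_def by blast

lemma image_of_intertwiner_invariant:
  assumes \<rho>: "is_rep G n \<rho>" and \<sigma>: "is_rep G m \<sigma>" and T: "T \<in> carrier_mat n m"
    and eq: "\<And>g. g \<in> carrier G \<Longrightarrow> \<rho> g * T = T * \<sigma> g"
    and g: "g \<in> carrier G" and w: "w \<in> (\<lambda>v. T *\<^sub>v v) ` carrier_vec m"
  shows "\<rho> g *\<^sub>v w \<in> (\<lambda>v. T *\<^sub>v v) ` carrier_vec m"
proof -
  obtain v where v: "v \<in> carrier_vec m" "w = T *\<^sub>v v" using w by blast
  have "\<rho> g *\<^sub>v w = (\<rho> g * T) *\<^sub>v v"
    unfolding v(2) using assoc_mult_mat_vec[OF rep_carrier[OF \<rho> g] T v(1)] by simp
  also have "\<dots> = T *\<^sub>v (\<sigma> g *\<^sub>v v)"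
    unfolding eq[OF g] by (rule assoc_mult_mat_vec[OF T rep_carrier[OF \<sigma> g] v(1)])
  finally show ?thesis using rep_carrier[OF \<sigma> g] v(1) by auto
qed

text \<open>
  Schur's lemma: the kernel and the image of an intertwiner are invariant subspaces.
\<close>

lemma schur_nonzero_bijective:
  assumes \<rho>: "is_irrep G n \<rho>" and \<sigma>: "is_irrep G m \<sigma>" and T: "T \<in> carrier_mat n m"
    and eq: "\<And>g. g \<in> carrier G \<Longrightarrow> \<rho> g * T = T * \<sigma> g"
    and nz: "T \<noteq> 0\<^sub>m n m"
  shows "inj_mat T" and "\<And>w. w \<in> carrier_vec n \<Longrightarrow> \<exists>v\<in>carrier_vec m. T *\<^sub>v v = w"
proof -
  let ?K = "{v \<in> carrier_vec m. T *\<^sub>v v = 0\<^sub>v n}"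
  let ?I = "(\<lambda>v. T *\<^sub>v v) ` carrier_vec m"
  obtain v0 where v0: "v0 \<in> carrier_vec m" "T *\<^sub>v v0 \<noteq> 0\<^sub>v n" using mat_eq_zeroI[OF T] nz by blast
  have "?K = {0\<^sub>v m} \<or> ?K = carrier_vec m"
  proof (rule irrepD[OF \<sigma> subspace_kernel[OF T]])
    fix g w assume g: "g \<in> carrier G" and w: "w \<in> ?K"
    have \<sigma>g: "\<sigma> g \<in> carrier_mat m m" and \<rho>g: "\<rho> g \<in> carrier_mat n n"
      using rep_carrier irrep_rep \<rho> \<sigma> g by blast+
    have w: "w \<in> carrier_vec m" "T *\<^sub>v w = 0\<^sub>v n" using w by auto
    have "T *\<^sub>v (\<sigma> g *\<^sub>v w) = (T * \<sigma> g) *\<^sub>v w"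
      using assoc_mult_mat_vec[OF T \<sigma>g w(1)] by simp
    also have "\<dots> = \<rho> g *\<^sub>v (T *\<^sub>v w)"
      unfolding eq[OF g, symmetric] by (rule assoc_mult_mat_vec[OF \<rho>g T w(1)])
    also have "\<dots> = 0\<^sub>v n" unfolding w(2) using \<rho>g by (intro eq_vecI) auto
    finally show "\<sigma> g *\<^sub>v w \<in> ?K" using \<sigma>g w by auto
  qed
  then have "?K = {0\<^sub>v m}" using v0 by blast
  then show "inj_mat T" unfolding inj_mat_def using T by auto
  have "?I = {0\<^sub>v n} \<or> ?I = carrier_vec n"
    using irrepD[OF \<rho> subspace_image[OF T]]
      image_of_intertwiner_invariant[OF irrep_rep[OF \<rho>] irrep_rep[OF \<sigma>] T eq] by blast
  then have "?I = carrier_vec n" using v0 by blast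
  then show "\<exists>v\<in>carrier_vec m. T *\<^sub>v v = w" if "w \<in> carrier_vec n" for w
    using that by (metis (mono_tags, lifting) image_iff)
qed

lemma nonzero_intertwiner_same_trace:
  assumes \<rho>: "is_irrep G n \<rho>" and \<sigma>: "is_irrep G m \<sigma>" and T: "T \<in> carrier_mat n m"
    and eq: "\<And>g. g \<in> carrier G \<Longrightarrow> \<rho> g * T = T * \<sigma> g"
    and nz: "T \<noteq> 0\<^sub>m n m" and g: "g \<in> carrier G"
  shows "mat_trace (\<rho> g) = mat_trace (\<sigma> g)"
proof (rule mat_trace_eq_of_bijective_intertwiner[OF _ _ T])
  show "inj_mat T" and "\<And>w. w \<in> carrier_vec n \<Longrightarrow> \<exists>v\<in>carrier_vec m. T *\<^sub>v v = w"
    using schur_nonzero_bijective[OF \<rho> \<sigma> T eq nz] by auto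
qed (use \<rho> \<sigma> g eq in \<open>auto intro: rep_carrier irrep_rep\<close>)

text \<open>
  For an eigenvalue \<open>c\<close> the intertwiner \<open>T - c\<close> is not injective, hence zero.
\<close>

lemma schur_scalar:
  assumes \<rho>: "is_irrep G n \<rho>" and T: "T \<in> carrier_mat n n"
    and eq: "\<And>g. g \<in> carrier G \<Longrightarrow> \<rho> g * T = T * \<rho> g"
  obtains c where "T = c \<cdot>\<^sub>m 1\<^sub>m n"
proof -
  obtain c where c: "eigenvalue T c"
    using spectrum_non_empty[OF T irrep_pos[OF \<rho>]] unfolding spectrum_def by auto
  define M where "M = T + (- c) \<cdot>\<^sub>m 1\<^sub>m n"
  have M: "M \<in> carrier_mat n n" unfolding M_def using T by simp
  have Mc: "M = char_matrix T c" unfolding M_def char_matrix_def using T by simp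
  obtain v where v: "v \<in> carrier_vec n" "v \<noteq> 0\<^sub>v n" "M *\<^sub>v v = 0\<^sub>v n"
    using c unfolding eigenvalue_char_matrix[OF T] Mc by blast
  have "M = 0\<^sub>m n n"
  proof (rule ccontr)
    assume nz: "M \<noteq> 0\<^sub>m n n"
    have "inj_mat M"
    proof (rule schur_nonzero_bijective(1)[OF \<rho> \<rho> M _ nz])
      fix g assume g: "g \<in> carrier G"
      have \<rho>g: "\<rho> g \<in> carrier_mat n n" using rep_carrier[OF irrep_rep[OF \<rho>] g] .
      show "\<rho> g * M = M * \<rho> g"
        unfolding M_def using \<rho>g T eq[OF g]
        by (simp add: mult_add_distrib_mat[of _ n n] add_mult_distrib_mat[of _ n n]
          mult_smult_distrib[of _ n n _ n] mult_smult_assoc_mat[of _ n n _ n])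
    qed
    then show False using inj_matD[OF _ M v(1,3)] v(2) by blast
  qed
  have "T = c \<cdot>\<^sub>m 1\<^sub>m n"
  proof (rule eq_matI)
    fix i j assume "i < dim_row (c \<cdot>\<^sub>m 1\<^sub>m n)" "j < dim_col (c \<cdot>\<^sub>m 1\<^sub>m n)"
    then have ij: "i < n" "j < n" by auto
    have "M $$ (i, j) = 0" using \<open>M = 0\<^sub>m n n\<close> ij by simp
    then show "T $$ (i, j) = (c \<cdot>\<^sub>m 1\<^sub>m n) $$ (i, j)" unfolding M_def using ij T by auto
  qed (use T in auto)
  then show ?thesis by (rule that)
qed

section \<open>Averaging and orthogonality\<close>

lemma bij_mult_left:
  assumes h: "h \<in> carrier G"
  shows "bij_betw (\<lambda>g. h \<otimes> g) (carrier G) (carrier G)"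
proof (rule bij_betw_byWitness[where f' = "\<lambda>g. inv h \<otimes> g"])
  show "\<forall>g\<in>carrier G. inv h \<otimes> (h \<otimes> g) = g" "\<forall>g\<in>carrier G. h \<otimes> (inv h \<otimes> g) = g"
    using h by (metis inv_closed l_inv l_one m_assoc, metis inv_closed r_inv l_one m_assoc)
qed (use h in auto)

lemma bij_mult_right:
  assumes h: "h \<in> carrier G"
  shows "bij_betw (\<lambda>g. g \<otimes> h) (carrier G) (carrier G)"
proof (rule bij_betw_byWitness[where f' = "\<lambda>g. g \<otimes> inv h"])
  show "\<forall>g\<in>carrier G. g \<otimes> h \<otimes> inv h = g" "\<forall>g\<in>carrier G. g \<otimes> inv h \<otimes> h = g"
    using h by (simp_all add: m_assoc)
qed (use h in auto)

lemma conj_cancel: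
  assumes "h \<in> carrier G" "g \<in> carrier G"
  shows "inv h \<otimes> (h \<otimes> g \<otimes> inv h) \<otimes> h = g" "h \<otimes> (inv h \<otimes> g \<otimes> h) \<otimes> inv h = g"
  using assms by (metis inv_closed inv_solve_left inv_solve_right m_closed m_assoc l_inv r_inv l_one r_one,
    metis inv_closed inv_solve_left inv_solve_right m_closed m_assoc l_inv r_inv l_one r_one)

lemma bij_conj:
  assumes h: "h \<in> carrier G"
  shows "bij_betw (\<lambda>g. h \<otimes> g \<otimes> inv h) (carrier G) (carrier G)"
  by (rule bij_betw_byWitness[where f' = "\<lambda>g. inv h \<otimes> g \<otimes> h"]) (use h in \<open>auto simp: conj_cancel\<close>)

definition average :: "nat \<Rightarrow> nat \<Rightarrow> ('a \<Rightarrow> complex mat) \<Rightarrow> ('a \<Rightarrow> complex mat) \<Rightarrow> complex mat \<Rightarrow> complex mat" where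
  "average n m \<rho> \<sigma> Y = mat_sum n m (\<lambda>g. \<rho> g * Y * \<sigma> (inv g)) (carrier G)"

text \<open>
  Multiplication by \<open>h\<close> only permutes the summands: it replaces \<open>g\<close> by \<open>h \<otimes> g\<close>.
\<close>

lemma average_intertwines:
  assumes \<rho>: "is_rep G n \<rho>" and \<sigma>: "is_rep G m \<sigma>" and Y: "Y \<in> carrier_mat n m" and h: "h \<in> carrier G"
  shows "\<rho> h * average n m \<rho> \<sigma> Y = average n m \<rho> \<sigma> Y * \<sigma> h"
proof -
  have c: "\<rho> g * Y * \<sigma> (inv g) \<in> carrier_mat n m" if "g \<in> carrier G" for g
    using rep_carrier[OF \<rho> that] rep_carrier[OF \<sigma> inv_closed[OF that]] Y by auto
  have "average n m \<rho> \<sigma> Y * \<sigma> h = mat_sum n m (\<lambda>g. \<rho> g * Y * \<sigma> (inv g) * \<sigma> h) (carrier G)"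
    unfolding average_def by (rule mat_sum_mat_mult[OF rep_carrier[OF \<sigma> h] c])
  also have "\<dots> = mat_sum n m (\<lambda>g. \<rho> (h \<otimes> g) * Y * \<sigma> (inv (h \<otimes> g)) * \<sigma> h) (carrier G)"
    by (rule mat_sum_reindex[OF bij_mult_left[OF h]])
  also have "\<dots> = mat_sum n m (\<lambda>g. \<rho> h * (\<rho> g * Y * \<sigma> (inv g))) (carrier G)"
  proof (rule mat_sum_cong)
    fix g assume g: "g \<in> carrier G"
    have cs: "\<rho> g \<in> carrier_mat n n" "\<rho> h \<in> carrier_mat n n" "\<sigma> h \<in> carrier_mat m m"
      "\<sigma> (inv g) \<in> carrier_mat m m" "\<sigma> (inv (h \<otimes> g)) \<in> carrier_mat m m"
      using rep_carrier \<rho> \<sigma> g h by auto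
    have "\<sigma> (inv (h \<otimes> g)) * \<sigma> h = \<sigma> (inv g)"
      using g h rep_mult[OF \<sigma>, of "inv (h \<otimes> g)" h] by (simp add: inv_mult_group m_assoc)
    then have "\<rho> (h \<otimes> g) * Y * \<sigma> (inv (h \<otimes> g)) * \<sigma> h = \<rho> (h \<otimes> g) * Y * \<sigma> (inv g)"
      using assoc_mult_mat[of "\<rho> (h \<otimes> g) * Y" n m "\<sigma> (inv (h \<otimes> g))" m "\<sigma> h" m] cs Y
        rep_carrier[OF \<rho> m_closed[OF h g]] by auto
    also have "\<dots> = \<rho> h * \<rho> g * Y * \<sigma> (inv g)" using rep_mult[OF \<rho> h g] by simp
    also have "\<dots> = \<rho> h * (\<rho> g * Y * \<sigma> (inv g))"
      using cs Y by (simp add: assoc_mult_mat[of _ n n _ n _ m] assoc_mult_mat[of _ n n _ m _ m])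
    finally show "\<rho> (h \<otimes> g) * Y * \<sigma> (inv (h \<otimes> g)) * \<sigma> h = \<rho> h * (\<rho> g * Y * \<sigma> (inv g))" .
  qed
  also have "\<dots> = \<rho> h * average n m \<rho> \<sigma> Y"
    unfolding average_def by (rule mat_mult_mat_sum[OF rep_carrier[OF \<rho> h] c, symmetric])
  finally show ?thesis ..
qed

text \<open>
  Expresses the pairing of two characters through averages of matrix units, to which Schur's lemma
  applies.
\<close>

lemma sum_trace_product_eq_averages:
  assumes \<rho>: "is_rep G n \<rho>" and \<sigma>: "is_rep G m \<sigma>"
  shows "(\<Sum>g\<in>carrier G. mat_trace (\<rho> g) * mat_trace (\<sigma> (inv g))) =
    (\<Sum>i<n. \<Sum>j<m. average n m \<rho> \<sigma> (elem_mat n m i j) $$ (i, j))"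
proof -
  have "(\<Sum>i<n. \<Sum>j<m. average n m \<rho> \<sigma> (elem_mat n m i j) $$ (i, j)) =
      (\<Sum>i<n. \<Sum>j<m. \<Sum>g\<in>carrier G. \<rho> g $$ (i, i) * \<sigma> (inv g) $$ (j, j))"
    unfolding average_def
    by (intro sum.cong refl) (auto intro!: sum.cong elem_mat_sandwich rep_carrier[OF \<rho>] rep_carrier[OF \<sigma>])
  also have "\<dots> = (\<Sum>i<n. \<Sum>g\<in>carrier G. \<Sum>j<m. \<rho> g $$ (i, i) * \<sigma> (inv g) $$ (j, j))"
    by (intro sum.cong refl sum.swap)
  also have "\<dots> = (\<Sum>g\<in>carrier G. \<Sum>i<n. \<Sum>j<m. \<rho> g $$ (i, i) * \<sigma> (inv g) $$ (j, j))"
    by (rule sum.swap)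
  also have "\<dots> = (\<Sum>g\<in>carrier G. mat_trace (\<rho> g) * mat_trace (\<sigma> (inv g)))"
  proof (intro sum.cong refl)
    fix g assume g: "g \<in> carrier G"
    have "dim_row (\<rho> g) = n" "dim_row (\<sigma> (inv g)) = m"
      using rep_carrier[OF \<rho> g] rep_carrier[OF \<sigma> inv_closed[OF g]] by auto
    then show "(\<Sum>i<n. \<Sum>j<m. \<rho> g $$ (i, i) * \<sigma> (inv g) $$ (j, j)) = mat_trace (\<rho> g) * mat_trace (\<sigma> (inv g))"
      unfolding mat_trace_def by (simp add: sum_product)
  qed
  finally show ?thesis ..
qed

lemma irrep_orthogonal:
  assumes \<rho>: "is_irrep G n \<rho>" and \<sigma>: "is_irrep G m \<sigma>"
    and h: "h \<in> carrier G" "mat_trace (\<rho> h) \<noteq> mat_trace (\<sigma> h)"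
  shows "(\<Sum>g\<in>carrier G. mat_trace (\<rho> g) * mat_trace (\<sigma> (inv g))) = 0"
proof -
  note reps = irrep_rep[OF \<rho>] irrep_rep[OF \<sigma>]
  have "average n m \<rho> \<sigma> (elem_mat n m i j) = 0\<^sub>m n m" for i j
  proof (rule ccontr)
    assume nz: "average n m \<rho> \<sigma> (elem_mat n m i j) \<noteq> 0\<^sub>m n m"
    have "mat_trace (\<rho> h) = mat_trace (\<sigma> h)"
      by (rule nonzero_intertwiner_same_trace[OF \<rho> \<sigma> _ average_intertwines[OF reps elem_mat_carrier] nz h(1)])
        (simp_all add: average_def)
    then show False using h(2) by simp
  qed
  then show ?thesis unfolding sum_trace_product_eq_averages[OF reps] by simp
qed

text \<open>
  The average of a matrix unit is a scalar matrix, and the scalar is determined by its trace, which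
  is \<open>|G|\<close> times the trace of the matrix unit. So only the \<open>n\<close> diagonal matrix units contribute, each
  with \<open>|G| / n\<close>.
\<close>

lemma irrep_norm:
  assumes \<rho>: "is_irrep G n \<rho>"
  shows "(\<Sum>g\<in>carrier G. mat_trace (\<rho> g) * mat_trace (\<rho> (inv g))) = of_nat (Coset.order G)"
proof -
  note rep = irrep_rep[OF \<rho>]
  have n: "of_nat n \<noteq> (0::complex)" using irrep_pos[OF \<rho>] by simp
  have avg: "average n n \<rho> \<rho> (elem_mat n n i j) $$ (i, j) = (if i = j then of_nat (Coset.order G) / of_nat n else 0)"
    if ij: "i < n" "j < n" for i j
  proof -
    let ?T = "average n n \<rho> \<rho> (elem_mat n n i j)"
    obtain c where c: "?T = c \<cdot>\<^sub>m 1\<^sub>m n"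
      using schur_scalar[OF \<rho> _ average_intertwines[OF rep rep elem_mat_carrier]]
      by (metis average_def mat_sum_carrier)
    have "c * of_nat n = mat_trace ?T" unfolding c by (simp add: mat_trace_smult_one)
    also have "\<dots> = (\<Sum>g\<in>carrier G. mat_trace (\<rho> g * elem_mat n n i j * \<rho> (inv g)))"
      unfolding average_def by (rule mat_trace_mat_sum) (auto intro!: mult_carrier_mat rep_carrier[OF rep])
    also have "\<dots> = (\<Sum>g\<in>carrier G. mat_trace (elem_mat n n i j))"
    proof (intro sum.cong refl)
      fix g assume g: "g \<in> carrier G"
      note cs = rep_carrier[OF rep g] rep_carrier[OF rep inv_closed[OF g]]
      have "mat_trace (\<rho> g * elem_mat n n i j * \<rho> (inv g)) = mat_trace (\<rho> (inv g) * (\<rho> g * elem_mat n n i j))"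
        by (rule mat_trace_mult_comm) (use cs in auto)
      also have "\<rho> (inv g) * (\<rho> g * elem_mat n n i j) = elem_mat n n i j"
        using assoc_mult_mat[OF cs(2,1) elem_mat_carrier, of n i j, symmetric] rep_inv(2)[OF rep g]
          left_mult_one_mat[OF elem_mat_carrier, of n n i j] by simp
      finally show "mat_trace (\<rho> g * elem_mat n n i j * \<rho> (inv g)) = mat_trace (elem_mat n n i j)" .
    qed
    also have "\<dots> = of_nat (Coset.order G) * (if i = j then 1 else 0)"
    proof -
      have "mat_trace (elem_mat n n i j) = (\<Sum>k<n. if k = i then (if i = j then 1 else 0) else 0)"
        unfolding mat_trace_def by (intro sum.cong) (auto simp: elem_mat_def)
      then show ?thesis using ij by (simp add: Coset.order_def)
    qed
    finally show ?thesis using n unfolding c using ij by (auto simp: field_simps)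
  qed
  have "(\<Sum>g\<in>carrier G. mat_trace (\<rho> g) * mat_trace (\<rho> (inv g))) =
      (\<Sum>i<n. \<Sum>j<n. if i = j then of_nat (Coset.order G) / of_nat n else 0)"
    unfolding sum_trace_product_eq_averages[OF rep rep] by (intro sum.cong refl) (simp add: avg)
  also have "\<dots> = of_nat (Coset.order G)" using n by simp
  finally show ?thesis .
qed

text \<open>
  The matrix \<open>H\<close> is the Gram matrix of a positive definite Hermitian form that is invariant under the
  group. Being invertible, it is an equivalence between \<open>\<rho>\<close> and its conjugate dual
  \<open>h \<mapsto> (\<rho> (inv h))\<^sup>*\<close>, and equivalent representations have the same traces.
\<close>

lemma rep_trace_inv:
  assumes \<rho>: "is_rep G n \<rho>" and h: "h \<in> carrier G"
  shows "mat_trace (\<rho> (inv h)) = cnj (mat_trace (\<rho> h))"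
proof -
  define H where "H = mat_sum n n (\<lambda>g. mat_adjoint (\<rho> g) * \<rho> g) (carrier G)"
  have H: "H \<in> carrier_mat n n" unfolding H_def by simp
  have cs: "\<rho> g \<in> carrier_mat n n" "mat_adjoint (\<rho> g) \<in> carrier_mat n n" if "g \<in> carrier G" for g
    using rep_carrier[OF \<rho> that] by auto
  have hi: "inv h \<in> carrier G" using h by simp
  have "H * \<rho> h = mat_sum n n (\<lambda>g. mat_adjoint (\<rho> g) * \<rho> g * \<rho> h) (carrier G)"
    unfolding H_def by (rule mat_sum_mat_mult[OF cs(1)[OF h]]) (auto intro: mult_carrier_mat cs)
  also have "\<dots> = mat_sum n n (\<lambda>g. mat_adjoint (\<rho> (g \<otimes> inv h)) * \<rho> (g \<otimes> inv h) * \<rho> h) (carrier G)"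
    by (rule mat_sum_reindex[OF bij_mult_right[OF hi]])
  also have "\<dots> = mat_sum n n (\<lambda>g. mat_adjoint (\<rho> (inv h)) * (mat_adjoint (\<rho> g) * \<rho> g)) (carrier G)"
  proof (rule mat_sum_cong)
    fix g assume g: "g \<in> carrier G"
    have a: "mat_adjoint (\<rho> (g \<otimes> inv h)) = mat_adjoint (\<rho> (inv h)) * mat_adjoint (\<rho> g)"
      unfolding rep_mult[OF \<rho> g hi] by (rule mat_adjoint_mult[OF cs(1)[OF g] cs(1)[OF hi]])
    have b: "\<rho> (g \<otimes> inv h) * \<rho> h = \<rho> g"
      using g h by (simp add: m_assoc flip: rep_mult[OF \<rho>])
    have "mat_adjoint (\<rho> (g \<otimes> inv h)) * \<rho> (g \<otimes> inv h) * \<rho> h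
        = mat_adjoint (\<rho> (g \<otimes> inv h)) * (\<rho> (g \<otimes> inv h) * \<rho> h)"
      by (rule assoc_mult_mat) (use g h in \<open>auto intro!: cs\<close>)
    also have "\<dots> = mat_adjoint (\<rho> (inv h)) * (mat_adjoint (\<rho> g) * \<rho> g)"
      unfolding a b by (rule assoc_mult_mat) (use g h in \<open>auto intro!: cs\<close>)
    finally show "mat_adjoint (\<rho> (g \<otimes> inv h)) * \<rho> (g \<otimes> inv h) * \<rho> h
        = mat_adjoint (\<rho> (inv h)) * (mat_adjoint (\<rho> g) * \<rho> g)" .
  qed
  also have "\<dots> = mat_adjoint (\<rho> (inv h)) * H"
    unfolding H_def by (rule mat_mult_mat_sum[OF cs(2)[OF hi], symmetric]) (auto intro: mult_carrier_mat cs)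
  finally have eq: "mat_adjoint (\<rho> (inv h)) * H = H * \<rho> h" ..
  \<comment> \<open>If \<open>H\<close> kills \<open>v\<close>, then \<open>v\<^sup>* H v\<close>, which is the sum of the squared norms of all \<open>\<rho> g v\<close>, is zero.
    The vector is written as a matrix \<open>V\<close> with one column.\<close>
  have inj: "inj_mat H"
    unfolding inj_mat_def
  proof (intro ballI impI)
    fix v assume v: "v \<in> carrier_vec (dim_col H)" and z: "H *\<^sub>v v = 0\<^sub>v (dim_row H)"
    have v: "v \<in> carrier_vec n" and z: "H *\<^sub>v v = 0\<^sub>v n" using v z H by auto
    define V where "V = mat_of_cols n [v]"
    have V: "V \<in> carrier_mat n 1" unfolding V_def by (auto intro: mat_of_cols_carrier)
    have V0: "V $$ (i, 0) = v $ i" if "i < n" for i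
      using that unfolding V_def by (simp add: mat_of_cols_index)
    have HV: "H * V = 0\<^sub>m n 1"
    proof (rule eq_matI)
      fix i j assume "i < dim_row (0\<^sub>m n 1 :: complex mat)" "j < dim_col (0\<^sub>m n 1 :: complex mat)"
      then have ij: "i < n" "j = 0" by auto
      have "(H * V) $$ (i, j) = (H *\<^sub>v v) $ i"
        using ij H V v by (simp add: V_def col_mat_of_cols)
      then show "(H * V) $$ (i, j) = 0\<^sub>m n 1 $$ (i, j)" using ij z by simp
    qed (use H V in auto)
    have "mat_adjoint V * (H * V) = mat_sum 1 1 (\<lambda>g. mat_adjoint (\<rho> g * V) * (\<rho> g * V)) (carrier G)"
    proof -
      have "H * V = mat_sum n 1 (\<lambda>g. mat_adjoint (\<rho> g) * \<rho> g * V) (carrier G)"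
        unfolding H_def by (rule mat_sum_mat_mult[OF V]) (auto intro: mult_carrier_mat cs)
      moreover have "mat_adjoint V * mat_sum n 1 (\<lambda>g. mat_adjoint (\<rho> g) * \<rho> g * V) (carrier G)
          = mat_sum 1 1 (\<lambda>g. mat_adjoint V * (mat_adjoint (\<rho> g) * \<rho> g * V)) (carrier G)"
        by (rule mat_mult_mat_sum[OF mat_adjoint_carrier[OF V]]) (intro mult_carrier_mat[OF _ V] mult_carrier_mat[OF cs(2) cs(1)])
      ultimately have "mat_adjoint V * (H * V) = mat_sum 1 1 (\<lambda>g. mat_adjoint V * (mat_adjoint (\<rho> g) * \<rho> g * V)) (carrier G)"
        by simp
      also have "\<dots> = mat_sum 1 1 (\<lambda>g. mat_adjoint (\<rho> g * V) * (\<rho> g * V)) (carrier G)"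
      proof (rule mat_sum_cong)
        fix g assume g: "g \<in> carrier G"
        note c = cs[OF g] mat_adjoint_carrier[OF V]
        have "mat_adjoint (\<rho> g * V) * (\<rho> g * V) = mat_adjoint V * mat_adjoint (\<rho> g) * (\<rho> g * V)"
          using mat_adjoint_mult[OF c(1) V] by simp
        also have "\<dots> = mat_adjoint V * (mat_adjoint (\<rho> g) * (\<rho> g * V))"
          by (rule assoc_mult_mat[OF c(3,2) mult_carrier_mat[OF c(1) V]])
        also have "mat_adjoint (\<rho> g) * (\<rho> g * V) = mat_adjoint (\<rho> g) * \<rho> g * V"
          by (rule assoc_mult_mat[OF c(2,1) V, symmetric])
        finally show "mat_adjoint V * (mat_adjoint (\<rho> g) * \<rho> g * V) = mat_adjoint (\<rho> g * V) * (\<rho> g * V)" ..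
      qed
      finally show ?thesis .
    qed
    moreover have "(mat_adjoint V * (H * V)) $$ (0, 0) = 0"
      unfolding HV using V by (auto simp: scalar_prod_def)
    ultimately have "(\<Sum>g\<in>carrier G. (mat_adjoint (\<rho> g * V) * (\<rho> g * V)) $$ (0, 0)) = 0" by simp
    also have "(\<Sum>g\<in>carrier G. (mat_adjoint (\<rho> g * V) * (\<rho> g * V)) $$ (0, 0))
        = of_real (\<Sum>g\<in>carrier G. \<Sum>i<n. (cmod ((\<rho> g * V) $$ (i, 0)))\<^sup>2)"
      unfolding of_real_sum[of _ "carrier G"]
      by (intro sum.cong refl adjoint_mult_self_diagonal[where m = 1] mult_carrier_mat[OF cs(1) V]) auto
    finally have s0: "(\<Sum>g\<in>carrier G. \<Sum>i<n. (cmod ((\<rho> g * V) $$ (i, 0)))\<^sup>2) = 0"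
      unfolding of_real_eq_0_iff .
    have "\<forall>g\<in>carrier G. (\<Sum>i<n. (cmod ((\<rho> g * V) $$ (i, 0)))\<^sup>2) = 0"
      using s0 by (subst (asm) sum_nonneg_eq_0_iff) (auto intro: sum_nonneg)
    then have "(\<Sum>i<n. (cmod ((\<rho> \<one> * V) $$ (i, 0)))\<^sup>2) = 0" by simp
    then have v0: "v $ i = 0" if "i < n" for i
      using that V V0 unfolding rep_one[OF \<rho>]
      by (subst (asm) sum_nonneg_eq_0_iff) auto
    have "v = 0\<^sub>v n" by (rule eq_vecI) (use v v0 in auto)
    then show "v = 0\<^sub>v (dim_col H)" using H by simp
  qed
  have "mat_trace (mat_adjoint (\<rho> (inv h))) = mat_trace (\<rho> h)"
    by (rule mat_trace_eq_of_bijective_intertwiner[OF cs(2)[OF hi] cs(1)[OF h] H inj _ eq])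
      (rule inj_mat_square_surj[OF H inj])
  then have "cnj (mat_trace (\<rho> (inv h))) = mat_trace (\<rho> h)"
    using mat_trace_adjoint[OF cs(1)[OF hi]] by simp
  then show ?thesis by (metis complex_cnj_cnj)
qed

section \<open>Irreducible subrepresentations\<close>

text \<open>
  Invariance of the image lets one solve \<open>\<rho> g * P = P * \<sigma> g\<close> for \<open>\<sigma> g\<close>; the solution is unique as
  \<open>P\<close> is injective, and uniqueness makes \<open>\<sigma>\<close> multiplicative.
\<close>

lemma subrep_on_image:
  assumes \<rho>: "is_rep G n \<rho>" and P: "P \<in> carrier_mat n m" "inj_mat P"
    and inv: "\<And>g v. g \<in> carrier G \<Longrightarrow> v \<in> carrier_vec m \<Longrightarrow> \<rho> g *\<^sub>v (P *\<^sub>v v) \<in> (\<lambda>v. P *\<^sub>v v) ` carrier_vec m"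
  obtains \<sigma> where "is_rep G m \<sigma>" "\<And>g. g \<in> carrier G \<Longrightarrow> \<rho> g * P = P * \<sigma> g"
proof -
  have "\<exists>Y\<in>carrier_mat m m. P * Y = \<rho> g * P" if g: "g \<in> carrier G" for g
  proof (rule columns_in_image_factor[OF _ P(1)])
    show "\<rho> g * P \<in> carrier_mat n m" using rep_carrier[OF \<rho> g] P by auto
    fix j assume j: "j < m"
    have "col (\<rho> g * P) j = \<rho> g *\<^sub>v (P *\<^sub>v unit_vec m j)"
      using col_mult2[OF rep_carrier[OF \<rho> g] P(1) j] mult_mat_unit_vec[OF P(1) j] by simp
    then show "\<exists>v\<in>carrier_vec m. P *\<^sub>v v = col (\<rho> g * P) j"
      using inv[OF g, of "unit_vec m j"] by auto
  qed
  then obtain \<sigma> where \<sigma>: "\<And>g. g \<in> carrier G \<Longrightarrow> \<sigma> g \<in> carrier_mat m m \<and> P * \<sigma> g = \<rho> g * P"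
    by metis
  have "is_rep G m \<sigma>"
    unfolding is_rep_iff
  proof (intro conjI ballI)
    have "P * \<sigma> \<one> = P * 1\<^sub>m m" using \<sigma>[of \<one>] rep_one[OF \<rho>] P by auto
    then show "\<sigma> \<one> = 1\<^sub>m m" using inj_mat_cancel[OF P(2,1), of "\<sigma> \<one>" m "1\<^sub>m m"] \<sigma> by auto
    fix g h assume g: "g \<in> carrier G" and h: "h \<in> carrier G"
    note cs = conjunct1[OF \<sigma>[OF g]] conjunct1[OF \<sigma>[OF h]] rep_carrier[OF \<rho> g] rep_carrier[OF \<rho> h]
    have "P * \<sigma> (g \<otimes> h) = \<rho> g * \<rho> h * P" using \<sigma>[of "g \<otimes> h"] g h rep_mult[OF \<rho> g h] by simp
    also have "\<dots> = \<rho> g * (\<rho> h * P)" by (rule assoc_mult_mat[OF cs(3,4) P(1)])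
    also have "\<rho> h * P = P * \<sigma> h" using \<sigma>[OF h] by simp
    also have "\<rho> g * (P * \<sigma> h) = \<rho> g * P * \<sigma> h" by (rule assoc_mult_mat[OF cs(3) P(1) cs(2), symmetric])
    also have "\<rho> g * P = P * \<sigma> g" using \<sigma>[OF g] by simp
    also have "P * \<sigma> g * \<sigma> h = P * (\<sigma> g * \<sigma> h)" by (rule assoc_mult_mat[OF P(1) cs(1,2)])
    finally show "\<sigma> (g \<otimes> h) = \<sigma> g * \<sigma> h"
      by (rule inj_mat_cancel[OF P(2,1), rotated 2]) (use \<sigma>[of "g \<otimes> h"] g h cs(1,2) in auto)
  qed (use \<sigma> in auto)
  then show ?thesis using that \<sigma> by metis
qed

text \<open>
  Among all nonzero subrepresentations inside \<open>W\<close>, one of least degree is irreducible, because a proper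
  invariant subspace would give one of smaller degree.
\<close>

lemma irreducible_subrep:
  assumes \<rho>: "is_rep G n \<rho>" and W: "VectorSpace.subspace class_ring W (module_vec TYPE(complex) n)"
    and inv: "\<And>g w. g \<in> carrier G \<Longrightarrow> w \<in> W \<Longrightarrow> \<rho> g *\<^sub>v w \<in> W" and nz: "W \<noteq> {0\<^sub>v n}"
  obtains m \<sigma> P where "is_irrep G m \<sigma>" "P \<in> carrier_mat n m" "inj_mat P"
    "\<And>v. v \<in> carrier_vec m \<Longrightarrow> P *\<^sub>v v \<in> W" "\<And>g. g \<in> carrier G \<Longrightarrow> \<rho> g * P = P * \<sigma> g"
proof -
  define good where "good = (\<lambda>m. 0 < m \<and> (\<exists>\<sigma> P. is_rep G m \<sigma> \<and> P \<in> carrier_mat n m \<and> inj_mat P \<and>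
    (\<forall>v\<in>carrier_vec m. P *\<^sub>v v \<in> W) \<and> (\<forall>g\<in>carrier G. \<rho> g * P = P * \<sigma> g)))"
  have "\<exists>m. good m"
  proof (cases "W = carrier_vec n")
    case True
    have "n \<noteq> 0"
    proof
      assume "n = 0"
      then have "W = {0\<^sub>v n}" unfolding True by (auto intro!: eq_vecI)
      then show False using nz by simp
    qed
    then have "good n" unfolding good_def
      using \<rho> True inj_mat_one left_mult_one_mat[OF rep_carrier[OF \<rho>]] right_mult_one_mat[OF rep_carrier[OF \<rho>]]
      by (intro conjI exI[of _ \<rho>] exI[of _ "1\<^sub>m n"]) auto
    then show ?thesis ..
  next
    case False
    obtain m P where m: "0 < m" "m < n" and P: "P \<in> carrier_mat n m" "inj_mat P" "W = (\<lambda>v. P *\<^sub>v v) ` carrier_vec m"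
      by (rule proper_subspace_as_image[OF W nz False])
    have "\<rho> g *\<^sub>v (P *\<^sub>v v) \<in> (\<lambda>v. P *\<^sub>v v) ` carrier_vec m" if "g \<in> carrier G" "v \<in> carrier_vec m" for g v
      using inv[OF that(1), of "P *\<^sub>v v"] that(2) unfolding P(3) by blast
    then obtain \<sigma> where "is_rep G m \<sigma>" "\<And>g. g \<in> carrier G \<Longrightarrow> \<rho> g * P = P * \<sigma> g"
      using subrep_on_image[OF \<rho> P(1,2)] by metis
    then have "good m" unfolding good_def using m P by blast
    then show ?thesis ..
  qed
  define m where "m = (LEAST m. good m)"
  have "good m" unfolding m_def using \<open>\<exists>m. good m\<close> by (rule LeastI_ex)
  have least: "\<not> good k" if "k < m" for k using not_less_Least that unfolding m_def by blast
  obtain \<sigma> P where m0: "0 < m" and \<sigma>: "is_rep G m \<sigma>" and P: "P \<in> carrier_mat n m" "inj_mat P"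
    and PW: "\<forall>v\<in>carrier_vec m. P *\<^sub>v v \<in> W" and eq: "\<forall>g\<in>carrier G. \<rho> g * P = P * \<sigma> g"
    using \<open>good m\<close> unfolding good_def by blast
  have "is_irrep G m \<sigma>"
    unfolding is_irrep_def
  proof (intro conjI allI impI \<sigma> m0)
    fix U assume U: "VectorSpace.subspace class_ring U (module_vec TYPE(complex) m)"
      and Uinv: "\<forall>g\<in>carrier G. \<forall>w\<in>U. \<sigma> g *\<^sub>v w \<in> U"
    show "U = {0\<^sub>v m} \<or> U = carrier_vec m"
    proof (rule ccontr)
      assume "\<not> (U = {0\<^sub>v m} \<or> U = carrier_vec m)"
      then have "U \<noteq> {0\<^sub>v m}" "U \<noteq> carrier_vec m" by auto
      then obtain k Q where k: "0 < k" "k < m" and Q: "Q \<in> carrier_mat m k" "inj_mat Q"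
        and UQ: "U = (\<lambda>v. Q *\<^sub>v v) ` carrier_vec k"
        by (rule proper_subspace_as_image[OF U])
      have "\<sigma> g *\<^sub>v (Q *\<^sub>v v) \<in> (\<lambda>v. Q *\<^sub>v v) ` carrier_vec k" if "g \<in> carrier G" "v \<in> carrier_vec k" for g v
        using Uinv that unfolding UQ by blast
      then obtain \<tau> where \<tau>: "is_rep G k \<tau>" "\<And>g. g \<in> carrier G \<Longrightarrow> \<sigma> g * Q = Q * \<tau> g"
        using subrep_on_image[OF \<sigma> Q] by metis
      have "good k" unfolding good_def
      proof (intro conjI exI[of _ \<tau>] exI[of _ "P * Q"] ballI k(1) \<tau>(1) inj_mat_mult[OF P(2,1) Q(2,1)])
        show "P * Q \<in> carrier_mat n k" using P Q by auto
        fix v :: "complex vec" assume v: "v \<in> carrier_vec k"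
        then show "(P * Q) *\<^sub>v v \<in> W"
          using PW Q assoc_mult_mat_vec[OF P(1) Q(1) v] by auto
      next
        fix g assume g: "g \<in> carrier G"
        note cs = rep_carrier[OF \<rho> g] rep_carrier[OF \<sigma> g] rep_carrier[OF \<tau>(1) g]
        have "\<rho> g * (P * Q) = \<rho> g * P * Q" by (rule assoc_mult_mat[OF cs(1) P(1) Q(1), symmetric])
        also have "\<rho> g * P = P * \<sigma> g" using eq g by blast
        also have "P * \<sigma> g * Q = P * (\<sigma> g * Q)" by (rule assoc_mult_mat[OF P(1) cs(2) Q(1)])
        also have "\<sigma> g * Q = Q * \<tau> g" using \<tau>(2) g by blast
        also have "P * (Q * \<tau> g) = P * Q * \<tau> g" by (rule assoc_mult_mat[OF P(1) Q(1) cs(3), symmetric])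
        finally show "\<rho> g * (P * Q) = P * Q * \<tau> g" .
      qed
      then show False using least k(2) by blast
    qed
  qed
  then show ?thesis using that P PW eq by blast
qed

section \<open>Completeness of the irreducible characters\<close>

definition class_function :: "('a \<Rightarrow> complex) \<Rightarrow> bool" where
  "class_function f \<longleftrightarrow> (\<forall>g\<in>carrier G. \<forall>h\<in>carrier G. f (h \<otimes> g \<otimes> inv h) = f g)"

text \<open>
  The action of the group algebra element \<open>\<Sum> f g \<cdot> g\<close> in the representation \<open>\<rho>\<close>.
\<close>

definition rep_sum :: "nat \<Rightarrow> ('a \<Rightarrow> complex mat) \<Rightarrow> ('a \<Rightarrow> complex) \<Rightarrow> complex mat" where
  "rep_sum n \<rho> f = mat_sum n n (\<lambda>g. f g \<cdot>\<^sub>m \<rho> g) (carrier G)"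

lemma rep_sum_carrier [simp]: "rep_sum n \<rho> f \<in> carrier_mat n n"
  by (simp add: rep_sum_def)

lemma mult_rep_sum:
  assumes \<rho>: "is_rep G n \<rho>" and A: "A \<in> carrier_mat k n"
  shows "A * rep_sum n \<rho> f = mat_sum k n (\<lambda>g. f g \<cdot>\<^sub>m (A * \<rho> g)) (carrier G)"
proof -
  have "A * rep_sum n \<rho> f = mat_sum k n (\<lambda>g. A * (f g \<cdot>\<^sub>m \<rho> g)) (carrier G)"
    unfolding rep_sum_def by (rule mat_mult_mat_sum[OF A]) (simp add: rep_carrier[OF \<rho>])
  also have "\<dots> = mat_sum k n (\<lambda>g. f g \<cdot>\<^sub>m (A * \<rho> g)) (carrier G)"
    by (rule mat_sum_cong) (rule mult_smult_distrib[OF A rep_carrier[OF \<rho>]])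
  finally show ?thesis .
qed

lemma rep_sum_mult:
  assumes \<rho>: "is_rep G n \<rho>" and A: "A \<in> carrier_mat n k"
  shows "rep_sum n \<rho> f * A = mat_sum n k (\<lambda>g. f g \<cdot>\<^sub>m (\<rho> g * A)) (carrier G)"
proof -
  have "rep_sum n \<rho> f * A = mat_sum n k (\<lambda>g. (f g \<cdot>\<^sub>m \<rho> g) * A) (carrier G)"
    unfolding rep_sum_def by (rule mat_sum_mat_mult[OF A]) (simp add: rep_carrier[OF \<rho>])
  also have "\<dots> = mat_sum n k (\<lambda>g. f g \<cdot>\<^sub>m (\<rho> g * A)) (carrier G)"
    by (rule mat_sum_cong) (rule mult_smult_assoc_mat[OF rep_carrier[OF \<rho>] A])
  finally show ?thesis .
qed

text \<open>
  Class functions are the central elements of the group algebra.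
\<close>

lemma rep_sum_commutes:
  assumes \<rho>: "is_rep G n \<rho>" and f: "class_function f" and h: "h \<in> carrier G"
  shows "\<rho> h * rep_sum n \<rho> f = rep_sum n \<rho> f * \<rho> h"
proof -
  have "rep_sum n \<rho> f * \<rho> h = mat_sum n n (\<lambda>g. f g \<cdot>\<^sub>m (\<rho> g * \<rho> h)) (carrier G)"
    by (rule rep_sum_mult[OF \<rho> rep_carrier[OF \<rho> h]])
  also have "\<dots> = mat_sum n n (\<lambda>g. f (h \<otimes> g \<otimes> inv h) \<cdot>\<^sub>m (\<rho> (h \<otimes> g \<otimes> inv h) * \<rho> h)) (carrier G)"
    by (rule mat_sum_reindex[OF bij_conj[OF h]])
  also have "\<dots> = mat_sum n n (\<lambda>g. f g \<cdot>\<^sub>m (\<rho> h * \<rho> g)) (carrier G)"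
  proof (rule mat_sum_cong)
    fix g assume g: "g \<in> carrier G"
    have "\<rho> (h \<otimes> g \<otimes> inv h) * \<rho> h = \<rho> h * \<rho> g"
      using g h by (simp add: m_assoc flip: rep_mult[OF \<rho>])
    then show "f (h \<otimes> g \<otimes> inv h) \<cdot>\<^sub>m (\<rho> (h \<otimes> g \<otimes> inv h) * \<rho> h) = f g \<cdot>\<^sub>m (\<rho> h * \<rho> g)"
      using f g h unfolding class_function_def by simp
  qed
  also have "\<dots> = \<rho> h * rep_sum n \<rho> f"
    by (rule mult_rep_sum[OF \<rho> rep_carrier[OF \<rho> h], symmetric])
  finally show ?thesis ..
qed

text \<open>
  By Schur's lemma the action is a scalar; its trace is the pairing of \<open>f\<close> with the character.
\<close>

lemma rep_sum_irrep_eq_zero: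
  assumes \<rho>: "is_irrep G n \<rho>" and f: "class_function f"
    and orth: "(\<Sum>g\<in>carrier G. f g * mat_trace (\<rho> g)) = 0"
  shows "rep_sum n \<rho> f = 0\<^sub>m n n"
proof -
  note rep = irrep_rep[OF \<rho>]
  obtain c where c: "rep_sum n \<rho> f = c \<cdot>\<^sub>m 1\<^sub>m n"
    using schur_scalar[OF \<rho> rep_sum_carrier rep_sum_commutes[OF rep f]] .
  have "c * of_nat n = mat_trace (rep_sum n \<rho> f)" unfolding c by (simp add: mat_trace_smult_one)
  also have "\<dots> = (\<Sum>g\<in>carrier G. mat_trace (f g \<cdot>\<^sub>m \<rho> g))"
    unfolding rep_sum_def by (rule mat_trace_mat_sum) (simp add: rep_carrier[OF rep])
  also have "\<dots> = (\<Sum>g\<in>carrier G. f g * mat_trace (\<rho> g))"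
  proof (intro sum.cong refl)
    fix g assume "g \<in> carrier G"
    then have "dim_row (\<rho> g) = n" "dim_col (\<rho> g) = n" using rep_carrier[OF rep] by auto
    then show "mat_trace (f g \<cdot>\<^sub>m \<rho> g) = f g * mat_trace (\<rho> g)"
      by (simp add: mat_trace_def sum_distrib_left)
  qed
  finally have "c = 0" using orth irrep_pos[OF \<rho>] by simp
  then show ?thesis unfolding c by (intro eq_matI) auto
qed

text \<open>
  The permutation matrices of left multiplication, with the group elements enumerated by \<open>e\<close>.
\<close>

definition regular_rep :: "(nat \<Rightarrow> 'a) \<Rightarrow> 'a \<Rightarrow> complex mat" where
  "regular_rep e g = mat (Coset.order G) (Coset.order G) (\<lambda>(i, j). if e i = g \<otimes> e j then 1 else 0)"

context
  fixes e assumes e: "bij_betw e {..<Coset.order G} (carrier G)"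
begin

lemma e_carrier: "i < Coset.order G \<Longrightarrow> e i \<in> carrier G"
  using e by (auto simp: bij_betw_def)

lemma e_obtain: "x \<in> carrier G \<Longrightarrow> \<exists>i<Coset.order G. e i = x"
  using e by (metis bij_betw_iff_bijections lessThan_iff)

lemma regular_rep_carrier [simp]: "regular_rep e g \<in> carrier_mat (Coset.order G) (Coset.order G)"
  by (simp add: regular_rep_def)

lemma regular_rep_is_rep: "is_rep G (Coset.order G) (regular_rep e)"
  unfolding is_rep_iff
proof (intro conjI ballI regular_rep_carrier)
  let ?N = "Coset.order G"
  have inj: "e i = e j \<longleftrightarrow> i = j" if "i < ?N" "j < ?N" for i j
    using e that by (auto simp: bij_betw_def inj_on_def)
  show "regular_rep e \<one> = 1\<^sub>m ?N"
    by (rule eq_matI) (auto simp: regular_rep_def e_carrier inj)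
  fix g h assume g: "g \<in> carrier G" and h: "h \<in> carrier G"
  show "regular_rep e (g \<otimes> h) = regular_rep e g * regular_rep e h"
  proof (rule eq_matI)
    fix i j assume "i < dim_row (regular_rep e g * regular_rep e h)" "j < dim_col (regular_rep e g * regular_rep e h)"
    then have ij: "i < ?N" "j < ?N" by (auto simp: regular_rep_def)
    obtain k where k: "k < ?N" "e k = h \<otimes> e j" using e_obtain h e_carrier[OF ij(2)] by blast
    have "(regular_rep e g * regular_rep e h) $$ (i, j) =
        (\<Sum>l<?N. regular_rep e g $$ (i, l) * regular_rep e h $$ (l, j))"
      by (rule mat_mult_index[OF regular_rep_carrier regular_rep_carrier ij])
    also have "\<dots> = (\<Sum>l<?N. if l = k then (if e i = g \<otimes> e l then 1 else 0) else 0)"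
      by (intro sum.cong refl) (use ij k inj in \<open>auto simp: regular_rep_def simp flip: k(2)\<close>)
    also have "\<dots> = regular_rep e (g \<otimes> h) $$ (i, j)"
      using k ij g h e_carrier[OF ij(2)] by (simp add: regular_rep_def m_assoc)
    finally show "regular_rep e (g \<otimes> h) $$ (i, j) = (regular_rep e g * regular_rep e h) $$ (i, j)" ..
  qed (auto simp: regular_rep_def)
qed

lemma rep_sum_regular_index:
  assumes ij: "i < Coset.order G" "j < Coset.order G"
  shows "rep_sum (Coset.order G) (regular_rep e) f $$ (i, j) = f (e i \<otimes> inv (e j))"
proof -
  note c = e_carrier[OF ij(1)] e_carrier[OF ij(2)]
  have "rep_sum (Coset.order G) (regular_rep e) f $$ (i, j) =
      (\<Sum>g\<in>carrier G. if g = e i \<otimes> inv (e j) then f g else 0)"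
    unfolding rep_sum_def mat_sum_index[OF ij]
  proof (intro sum.cong refl)
    fix g assume g: "g \<in> carrier G"
    have "e i = g \<otimes> e j \<longleftrightarrow> g = e i \<otimes> inv (e j)" using g c by (metis inv_solve_right)
    then show "(f g \<cdot>\<^sub>m regular_rep e g) $$ (i, j) = (if g = e i \<otimes> inv (e j) then f g else 0)"
      using ij by (simp add: regular_rep_def)
  qed
  then show ?thesis using c by simp
qed

text \<open>
  The adjoint of the action of \<open>f\<close> is again the action of a group algebra element. For a class
  function \<open>f\<close>, whose action is central, this makes the action a normal matrix.
\<close>

lemma adjoint_rep_sum_regular:
  "mat_adjoint (rep_sum (Coset.order G) (regular_rep e) f) =
    rep_sum (Coset.order G) (regular_rep e) (\<lambda>g. cnj (f (inv g)))"
proof (rule eq_matI)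
  let ?N = "Coset.order G"
  have d: "dim_row (rep_sum ?N (regular_rep e) f) = ?N" "dim_col (rep_sum ?N (regular_rep e) f) = ?N" for f
    by (simp_all add: rep_sum_def)
  {
    fix i j assume "i < dim_row (rep_sum ?N (regular_rep e) (\<lambda>g. cnj (f (inv g))))"
      "j < dim_col (rep_sum ?N (regular_rep e) (\<lambda>g. cnj (f (inv g))))"
    then have ij: "i < ?N" "j < ?N" by (auto simp: d)
    note c = e_carrier[OF ij(1)] e_carrier[OF ij(2)]
    have "mat_adjoint (rep_sum ?N (regular_rep e) f) $$ (i, j) = cnj (f (e j \<otimes> inv (e i)))"
      using ij by (simp add: mat_adjoint_index d rep_sum_regular_index)
    also have "e j \<otimes> inv (e i) = inv (e i \<otimes> inv (e j))" using c by (simp add: inv_mult_group)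
    finally show "mat_adjoint (rep_sum ?N (regular_rep e) f) $$ (i, j) =
        rep_sum ?N (regular_rep e) (\<lambda>g. cnj (f (inv g))) $$ (i, j)"
      using ij by (simp add: rep_sum_regular_index)
  }
qed (simp_all add: rep_sum_def)

end

text \<open>
  Let \<open>T\<close> be the action of \<open>f\<close> in the regular representation. If \<open>T\<close> is not zero, its image is a nonzero
  invariant subspace and contains an irreducible subrepresentation, on which \<open>T\<close> acts as zero because
  \<open>f\<close> is orthogonal to all irreducible characters. But \<open>T\<close> is normal, so its kernel and its image meet
  only in zero. Hence \<open>T = 0\<close>, and the entries of \<open>T\<close> are the values of \<open>f\<close>.
\<close>

lemma class_function_orthogonal_to_irreps_eq_zero:
  assumes f: "class_function f"
    and orth: "\<And>n \<rho>. is_irrep G n \<rho> \<Longrightarrow> (\<Sum>g\<in>carrier G. f g * mat_trace (\<rho> g)) = 0"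
    and x: "x \<in> carrier G"
  shows "f x = 0"
proof -
  let ?N = "Coset.order G"
  obtain e where e: "bij_betw e {..<?N} (carrier G)"
    using ex_bij_betw_nat_finite[OF finite_carrier] unfolding Coset.order_def lessThan_atLeast0 by blast
  define R where "R = regular_rep e"
  have R: "is_rep G ?N R" unfolding R_def by (rule regular_rep_is_rep[OF e])
  define T where "T = rep_sum ?N R f"
  have T: "T \<in> carrier_mat ?N ?N" unfolding T_def by simp
  have comm: "R g * T = T * R g" if "g \<in> carrier G" for g
    unfolding T_def by (rule rep_sum_commutes[OF R f that])
  define T' where "T' = mat_adjoint T"
  have T': "T' \<in> carrier_mat ?N ?N" unfolding T'_def using T by simp
  have normal: "T * T' = T' * T"
  proof -
    have T'R: "T' = rep_sum ?N R (\<lambda>g. cnj (f (inv g)))"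
      unfolding T'_def T_def R_def by (rule adjoint_rep_sum_regular[OF e])
    show ?thesis
      unfolding T'R mult_rep_sum[OF R T] rep_sum_mult[OF R T]
      by (rule mat_sum_cong) (simp add: comm)
  qed
  have "T = 0\<^sub>m ?N ?N"
  proof (rule ccontr)
    assume nz: "T \<noteq> 0\<^sub>m ?N ?N"
    let ?W = "(\<lambda>v. T *\<^sub>v v) ` carrier_vec ?N"
    have "?W \<noteq> {0\<^sub>v ?N}" using mat_eq_zeroI[OF T] nz by blast
    then obtain m \<sigma> P where \<sigma>: "is_irrep G m \<sigma>" and P: "P \<in> carrier_mat ?N m" "inj_mat P"
      and PW: "\<And>v. v \<in> carrier_vec m \<Longrightarrow> P *\<^sub>v v \<in> ?W" and eq: "\<And>g. g \<in> carrier G \<Longrightarrow> R g * P = P * \<sigma> g"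
      using irreducible_subrep[OF R subspace_image[OF T] image_of_intertwiner_invariant[OF R R T comm]] by blast
    have "\<exists>U\<in>carrier_mat ?N m. T * U = P"
    proof (rule columns_in_image_factor[OF _ T P(1)])
      fix j assume j: "j < m"
      show "\<exists>v\<in>carrier_vec ?N. T *\<^sub>v v = col P j"
        using PW[of "unit_vec m j"] mult_mat_unit_vec[OF P(1) j] by auto
    qed
    then obtain U where U: "U \<in> carrier_mat ?N m" "T * U = P" by blast
    have "T * P = P * rep_sum m \<sigma> f"
      unfolding T_def rep_sum_mult[OF R P(1)] mult_rep_sum[OF irrep_rep[OF \<sigma>] P(1)]
      by (rule mat_sum_cong) (simp add: eq)
    also have "\<dots> = 0\<^sub>m ?N m"
      unfolding rep_sum_irrep_eq_zero[OF \<sigma> f orth[OF \<sigma>]] using P by simp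
    finally have TP: "T * P = 0\<^sub>m ?N m" .
    \<comment> \<open>Normality: \<open>(T' P)\<^sup>* (T' P) = P\<^sup>* T T' P = P\<^sup>* T' T P = 0\<close>.\<close>
    have T'P: "T' * P = 0\<^sub>m ?N m"
    proof (rule adjoint_mult_self_eq_zero)
      show "T' * P \<in> carrier_mat ?N m" using T' P by auto
      have "mat_adjoint (T' * P) = mat_adjoint P * T"
        using mat_adjoint_mult[OF T' P(1)] unfolding T'_def mat_adjoint_adjoint .
      then have "mat_adjoint (T' * P) * (T' * P) = mat_adjoint P * (T * (T' * P))"
        using assoc_mult_mat[OF mat_adjoint_carrier[OF P(1)] T, of "T' * P" m] T' P by auto
      also have "T * (T' * P) = T * T' * P" using assoc_mult_mat[OF T T' P(1)] by simp
      also have "\<dots> = T' * (T * P)" unfolding normal using assoc_mult_mat[OF T' T P(1)] by simp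
      also have "mat_adjoint P * (T' * (T * P)) = 0\<^sub>m m m" unfolding TP right_mult_zero_mat[OF T'] by (rule right_mult_zero_mat[OF mat_adjoint_carrier[OF P(1)]])
      finally show "mat_adjoint (T' * P) * (T' * P) = 0\<^sub>m m m" .
    qed
    \<comment> \<open>The columns of \<open>P = T U\<close> lie in the image of \<open>T\<close>, so \<open>P\<^sup>* P = U\<^sup>* T' P = 0\<close>.\<close>
    have "P = 0\<^sub>m ?N m"
    proof (rule adjoint_mult_self_eq_zero[OF P(1)])
      have "mat_adjoint P = mat_adjoint U * T'"
        unfolding U(2)[symmetric] T'_def by (rule mat_adjoint_mult[OF T U(1)])
      then have "mat_adjoint P * P = mat_adjoint U * (T' * P)"
        using assoc_mult_mat[OF mat_adjoint_carrier[OF U(1)] T' P(1)] by simp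
      also have "\<dots> = 0\<^sub>m m m" unfolding T'P by (rule right_mult_zero_mat[OF mat_adjoint_carrier[OF U(1)]])
      finally show "mat_adjoint P * P = 0\<^sub>m m m" .
    qed
    then have "P *\<^sub>v unit_vec m 0 = 0\<^sub>v ?N" by (intro eq_vecI) auto
    then have "unit_vec m 0 = (0\<^sub>v m :: complex vec)" using inj_matD[OF P(2,1)] by simp
    then show False using irrep_pos[OF \<sigma>] by simp
  qed
  obtain i j where ij: "i < ?N" "j < ?N" "e i = x" "e j = \<one>"
    using e_obtain[OF e] x one_closed by metis
  have "f x = T $$ (i, j)" unfolding T_def R_def using rep_sum_regular_index[OF e ij(1,2), of f] ij x by simp
  then show ?thesis using \<open>T = 0\<^sub>m ?N ?N\<close> ij by simp
qed

section \<open>Irreducible characters\<close>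


lemma IrrE:
  assumes "\<chi> \<in> Irr G"
  obtains n \<rho> where "is_irrep G n \<rho>" "\<And>g. g \<in> carrier G \<Longrightarrow> \<chi> g = mat_trace (\<rho> g)"
  using assms unfolding Irr_def by auto

lemma irrep_character_in_Irr:
  "is_irrep G n \<rho> \<Longrightarrow> (\<lambda>g\<in>carrier G. mat_trace (\<rho> g)) \<in> Irr G"
  unfolding Irr_def by blast

text \<open>
  Elements of \<open>Irr G\<close> are extensional functions.
\<close>

lemma Irr_eqI:
  assumes "\<chi> \<in> Irr G" "\<psi> \<in> Irr G" "\<And>g. g \<in> carrier G \<Longrightarrow> \<chi> g = \<psi> g"
  shows "\<chi> = \<psi>"
proof -
  have "\<chi> \<in> extensional (carrier G)" "\<psi> \<in> extensional (carrier G)"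
    using assms(1,2) unfolding Irr_def by auto
  then show ?thesis using assms(3) by (rule extensionalityI)
qed

lemma Irr_orthogonal:
  assumes "\<chi> \<in> Irr G" "\<psi> \<in> Irr G" "\<chi> \<noteq> \<psi>"
  shows "(\<Sum>g\<in>carrier G. \<chi> g * \<psi> (inv g)) = 0"
proof -
  obtain n \<rho> where \<rho>: "is_irrep G n \<rho>" "\<And>g. g \<in> carrier G \<Longrightarrow> \<chi> g = mat_trace (\<rho> g)"
    using IrrE[OF assms(1)] by metis
  obtain m \<sigma> where \<sigma>: "is_irrep G m \<sigma>" "\<And>g. g \<in> carrier G \<Longrightarrow> \<psi> g = mat_trace (\<sigma> g)"
    using IrrE[OF assms(2)] by metis
  obtain h where "h \<in> carrier G" "\<chi> h \<noteq> \<psi> h" using Irr_eqI assms by blast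
  then show ?thesis using irrep_orthogonal[OF \<rho>(1) \<sigma>(1)] \<rho>(2) \<sigma>(2) by simp
qed

lemma Irr_norm:
  assumes "\<chi> \<in> Irr G"
  shows "(\<Sum>g\<in>carrier G. \<chi> g * \<chi> (inv g)) = of_nat (Coset.order G)"
proof -
  obtain n \<rho> where \<rho>: "is_irrep G n \<rho>" "\<And>g. g \<in> carrier G \<Longrightarrow> \<chi> g = mat_trace (\<rho> g)"
    using IrrE[OF assms] by metis
  then show ?thesis using irrep_norm[OF \<rho>(1)] by simp
qed

lemma Irr_inv:
  assumes "\<chi> \<in> Irr G" "g \<in> carrier G"
  shows "\<chi> (inv g) = cnj (\<chi> g)"
proof -
  obtain n \<rho> where \<rho>: "is_irrep G n \<rho>" "\<And>g. g \<in> carrier G \<Longrightarrow> \<chi> g = mat_trace (\<rho> g)"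
    using IrrE[OF assms(1)] by metis
  then show ?thesis using rep_trace_inv[OF irrep_rep[OF \<rho>(1)] assms(2)] assms(2) by simp
qed

lemma Irr_degree:
  assumes "\<chi> \<in> Irr G"
  obtains n :: nat where "0 < n" "\<chi> \<one> = of_nat n"
proof -
  obtain n \<rho> where \<rho>: "is_irrep G n \<rho>" "\<And>g. g \<in> carrier G \<Longrightarrow> \<chi> g = mat_trace (\<rho> g)"
    using IrrE[OF assms] by metis
  have "\<chi> \<one> = of_nat n" using \<rho> rep_one[OF irrep_rep[OF \<rho>(1)]] by (simp add: mat_trace_def)
  then show ?thesis using that irrep_pos[OF \<rho>(1)] by blast
qed

lemma Irr_class_function:
  assumes "\<chi> \<in> Irr G"
  shows "class_function \<chi>"
  unfolding class_function_def
proof (intro ballI)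
  fix g h assume g: "g \<in> carrier G" and h: "h \<in> carrier G"
  obtain n \<rho> where \<rho>: "is_irrep G n \<rho>" "\<And>g. g \<in> carrier G \<Longrightarrow> \<chi> g = mat_trace (\<rho> g)"
    using IrrE[OF assms] by metis
  note rep = irrep_rep[OF \<rho>(1)]
  have hi: "inv h \<in> carrier G" using h by simp
  have "\<chi> (h \<otimes> g \<otimes> inv h) = mat_trace (\<rho> (h \<otimes> g) * \<rho> (inv h))"
    using \<rho>(2)[of "h \<otimes> g \<otimes> inv h"] rep_mult[OF rep m_closed[OF h g] hi] g h by simp
  also have "\<dots> = mat_trace (\<rho> (inv h) * \<rho> (h \<otimes> g))"
    by (rule mat_trace_mult_comm[OF rep_carrier[OF rep m_closed[OF h g]] rep_carrier[OF rep hi]])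
  also have "\<rho> (inv h) * \<rho> (h \<otimes> g) = \<rho> g"
    using g h by (simp add: m_assoc[symmetric] flip: rep_mult[OF rep])
  finally show "\<chi> (h \<otimes> g \<otimes> inv h) = \<chi> g" using \<rho>(2) g by simp
qed

text \<open>
  A central element acts by a scalar \<open>c\<close>.
\<close>

lemma Irr_central:
  assumes \<chi>: "\<chi> \<in> Irr G" and z: "z \<in> group_center G"
  obtains c where "\<chi> z = c * \<chi> \<one>" "c \<noteq> 0" "z \<otimes> z = \<one> \<Longrightarrow> c * c = 1"
proof -
  obtain n \<rho> where \<rho>: "is_irrep G n \<rho>" "\<And>g. g \<in> carrier G \<Longrightarrow> \<chi> g = mat_trace (\<rho> g)"
    using IrrE[OF \<chi>] by metis
  note rep = irrep_rep[OF \<rho>(1)]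
  have zG: "z \<in> carrier G" and comm: "\<And>g. g \<in> carrier G \<Longrightarrow> z \<otimes> g = g \<otimes> z"
    using z unfolding group_center_def by auto
  obtain c where c: "\<rho> z = c \<cdot>\<^sub>m 1\<^sub>m n"
    using schur_scalar[OF \<rho>(1) rep_carrier[OF rep zG]] comm zG by (metis rep_mult[OF rep])
  have n: "0 < n" by (rule irrep_pos[OF \<rho>(1)])
  have mult: "\<rho> z * B = c \<cdot>\<^sub>m B" if "B \<in> carrier_mat n n" for B
    unfolding c using mult_smult_assoc_mat[OF one_carrier_mat that] left_mult_one_mat[OF that] by simp
  have "\<chi> z = c * \<chi> \<one>"
    using \<rho>(2) zG rep_one[OF rep] by (simp add: c mat_trace_smult_one) (simp add: mat_trace_def)
  moreover have "c \<noteq> 0"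
  proof
    assume "c = 0"
    have "1\<^sub>m n = c \<cdot>\<^sub>m \<rho> (inv z)"
      using mult[OF rep_carrier[OF rep inv_closed[OF zG]]] rep_inv(1)[OF rep zG] by simp
    then have "(1\<^sub>m n :: complex mat) $$ (0, 0) = (c \<cdot>\<^sub>m \<rho> (inv z)) $$ (0, 0)" by simp
    then show False using n \<open>c = 0\<close> rep_carrier[OF rep inv_closed[OF zG]] by auto
  qed
  moreover have "c * c = 1" if "z \<otimes> z = \<one>"
  proof -
    have "1\<^sub>m n = c \<cdot>\<^sub>m \<rho> z"
      using mult[OF rep_carrier[OF rep zG]] rep_mult[OF rep zG zG] that rep_one[OF rep] by simp
    then have "(1\<^sub>m n :: complex mat) $$ (0, 0) = (c \<cdot>\<^sub>m \<rho> z) $$ (0, 0)" by simp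
    then show ?thesis using n unfolding c by simp
  qed
  ultimately show ?thesis by (rule that)
qed

lemma trivial_character_in_Irr: "(\<lambda>g\<in>carrier G. 1) \<in> Irr G"
proof -
  have "is_irrep G 1 (\<lambda>_. 1\<^sub>m 1)"
    unfolding is_irrep_def
  proof (intro conjI allI impI)
    show "is_rep G 1 (\<lambda>_. 1\<^sub>m 1)" unfolding is_rep_iff by auto
    fix W :: "complex vec set" assume "VectorSpace.subspace class_ring W (module_vec TYPE(complex) 1)"
    then have W: "W \<subseteq> carrier_vec 1" "0\<^sub>v 1 \<in> W" "\<And>c v. v \<in> W \<Longrightarrow> c \<cdot>\<^sub>v v \<in> W"
      unfolding subspace_module_vec_iff by auto
    show "W = {0\<^sub>v 1} \<or> W = carrier_vec 1"
    proof (cases "W = {0\<^sub>v 1}")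
      case False
      then obtain w where w: "w \<in> W" "w \<noteq> 0\<^sub>v 1" using W(2) by blast
      have wc: "w \<in> carrier_vec 1" using w W by blast
      have w0: "w $ 0 \<noteq> 0"
      proof
        assume "w $ 0 = 0"
        then have "w = 0\<^sub>v 1" by (intro eq_vecI) (use wc in auto)
        then show False using w(2) by simp
      qed
      have "v \<in> W" if v: "v \<in> carrier_vec 1" for v
      proof -
        have "v = (v $ 0 / w $ 0) \<cdot>\<^sub>v w" by (rule eq_vecI) (use v wc w0 in auto)
        then show ?thesis using W(3)[OF w(1)] by metis
      qed
      then show ?thesis using W(1) by blast
    qed simp
  qed simp
  from irrep_character_in_Irr[OF this] show ?thesis by (simp add: mat_trace_def)
qed

section \<open>The center and conjugation counts\<close>

lemma commute_inv:
  assumes "g \<in> carrier G" "a \<in> carrier G" "g \<otimes> a = a \<otimes> g"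
  shows "inv g \<otimes> a = a \<otimes> inv g"
proof -
  have "inv g \<otimes> a = inv g \<otimes> (a \<otimes> g) \<otimes> inv g" using assms(1,2) by (simp add: m_assoc)
  also have "\<dots> = inv g \<otimes> (g \<otimes> a) \<otimes> inv g" using assms(3) by simp
  also have "\<dots> = a \<otimes> inv g" using assms(1,2) by (simp add: m_assoc[symmetric])
  finally show ?thesis .
qed

lemma group_center_subgroup: "subgroup (group_center G) G"
proof (rule subgroupI)
  show "group_center G \<noteq> {}" unfolding group_center_def by auto
  fix a assume a: "a \<in> group_center G"
  then have aG: "a \<in> carrier G" and comm: "\<And>g. g \<in> carrier G \<Longrightarrow> a \<otimes> g = g \<otimes> a"
    unfolding group_center_def by auto
  have "inv a \<otimes> g = g \<otimes> inv a" if g: "g \<in> carrier G" for g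
    using commute_inv[OF aG g comm[OF g]] .
  then show "inv a \<in> group_center G" unfolding group_center_def using aG by simp
  fix b assume b: "b \<in> group_center G"
  then have bG: "b \<in> carrier G" and comm': "\<And>g. g \<in> carrier G \<Longrightarrow> b \<otimes> g = g \<otimes> b"
    unfolding group_center_def by auto
  have "a \<otimes> b \<otimes> g = g \<otimes> (a \<otimes> b)" if g: "g \<in> carrier G" for g
    using comm comm' aG bG g by (metis m_assoc)
  then show "a \<otimes> b \<in> group_center G" unfolding group_center_def using aG bG by simp
qed (auto simp: group_center_def)

text \<open>
  Up to the factor \<open>|C(a)|\<close> this is the indicator function of the conjugacy class of \<open>a\<close>. With this
  normalization neither class sizes nor representatives of classes enter the computations.
\<close>

definition conj_count :: "'a \<Rightarrow> 'a \<Rightarrow> nat" where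
  "conj_count a x = card {g \<in> carrier G. g \<otimes> a \<otimes> inv g = x}"

text \<open>
  Grouping the sum \<open>\<Sum>g. f (g a g\<^sup>-\<^sup>1)\<close>, all of whose terms are \<open>f a\<close>, by the value of the conjugate.
\<close>

lemma sum_conj_count:
  assumes a: "a \<in> carrier G" and f: "class_function f"
  shows "(\<Sum>x\<in>carrier G. of_nat (conj_count a x) * f x) = of_nat (Coset.order G) * f a"
proof -
  have "(\<Sum>x\<in>carrier G. of_nat (conj_count a x) * f x) =
      (\<Sum>x\<in>carrier G. \<Sum>g\<in>{g \<in> carrier G. g \<otimes> a \<otimes> inv g = x}. f (g \<otimes> a \<otimes> inv g))"
    unfolding conj_count_def by (intro sum.cong refl) simp
  also have "\<dots> = (\<Sum>g\<in>carrier G. f (g \<otimes> a \<otimes> inv g))"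
    by (rule sum.group) (use a in auto)
  also have "\<dots> = (\<Sum>g\<in>carrier G. f a)"
    using f a unfolding class_function_def by (intro sum.cong refl) auto
  finally show ?thesis by (simp add: Coset.order_def)
qed

text \<open>
  Left multiplication by \<open>h\<close> maps the elements conjugating \<open>a\<close> to \<open>x\<close> onto those conjugating \<open>a\<close> to
  \<open>h x h\<^sup>-\<^sup>1\<close>.
\<close>

lemma conj_count_class_function:
  assumes a: "a \<in> carrier G" and h: "h \<in> carrier G" and x: "x \<in> carrier G"
  shows "conj_count a (h \<otimes> x \<otimes> inv h) = conj_count a x"
proof -
  have conj_mult: "(h \<otimes> g) \<otimes> a \<otimes> inv (h \<otimes> g) = h \<otimes> (g \<otimes> a \<otimes> inv g) \<otimes> inv h" if "g \<in> carrier G" for g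
    using that a h by (simp add: inv_mult_group m_assoc)
  have "bij_betw (\<lambda>g. h \<otimes> g) {g \<in> carrier G. g \<otimes> a \<otimes> inv g = x}
      {g \<in> carrier G. g \<otimes> a \<otimes> inv g = h \<otimes> x \<otimes> inv h}"
    unfolding bij_betw_def
  proof (intro conjI equalityI subsetI)
    show "inj_on (\<lambda>g. h \<otimes> g) {g \<in> carrier G. g \<otimes> a \<otimes> inv g = x}"
      using bij_mult_left[OF h] unfolding bij_betw_def by (auto intro: inj_on_subset)
    fix k assume k: "k \<in> {g \<in> carrier G. g \<otimes> a \<otimes> inv g = h \<otimes> x \<otimes> inv h}"
    then obtain g where g: "g \<in> carrier G" "k = h \<otimes> g"
      using bij_mult_left[OF h] unfolding bij_betw_def by blast
    have "h \<otimes> (g \<otimes> a \<otimes> inv g) \<otimes> inv h = h \<otimes> x \<otimes> inv h" using k g conj_mult by auto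
    then have "g \<otimes> a \<otimes> inv g = x" using g(1) a h x by simp
    then show "k \<in> (\<lambda>g. h \<otimes> g) ` {g \<in> carrier G. g \<otimes> a \<otimes> inv g = x}" using g by auto
  qed (use conj_mult h in auto)
  then show ?thesis unfolding conj_count_def using bij_betw_same_card by fastforce
qed

lemma conj_count_one:
  assumes x: "x \<in> carrier G"
  shows "conj_count \<one> x = (if x = \<one> then Coset.order G else 0)"
proof -
  have "{g \<in> carrier G. g \<otimes> \<one> \<otimes> inv g = x} = (if x = \<one> then carrier G else {})" by auto
  then show ?thesis unfolding conj_count_def Coset.order_def by simp
qed

lemma conj_count_eq_zero_iff:
  "conj_count a x = 0 \<longleftrightarrow> (\<forall>g\<in>carrier G. g \<otimes> a \<otimes> inv g \<noteq> x)"
  unfolding conj_count_def by auto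

lemma conj_eq_one_iff: "g \<in> carrier G \<Longrightarrow> a \<in> carrier G \<Longrightarrow> g \<otimes> a \<otimes> inv g = \<one> \<longleftrightarrow> a = \<one>"
  by (metis conj_cancel(1) inv_closed l_inv r_inv r_one)

text \<open>
  \<open>conj_count a a\<close> is the order of the centralizer of \<open>a\<close>.
\<close>

lemma conj_count_self_dvd_order:
  assumes a: "a \<in> carrier G"
  shows "conj_count a a dvd Coset.order G"
proof -
  let ?C = "{g \<in> carrier G. g \<otimes> a \<otimes> inv g = a}"
  have C: "?C = {g \<in> carrier G. g \<otimes> a = a \<otimes> g}"
    using a by (auto, metis inv_solve_right m_closed, metis inv_solve_right m_closed)
  have "subgroup ?C G"
    unfolding C
  proof (rule subgroupI)
    show "{g \<in> carrier G. g \<otimes> a = a \<otimes> g} \<noteq> {}" using a by (auto intro!: exI[of _ \<one>])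
    fix g assume g: "g \<in> {g \<in> carrier G. g \<otimes> a = a \<otimes> g}"
    then show "inv g \<in> {g \<in> carrier G. g \<otimes> a = a \<otimes> g}"
      using a commute_inv by simp
    fix h assume h: "h \<in> {g \<in> carrier G. g \<otimes> a = a \<otimes> g}"
    have gG: "g \<in> carrier G" and hG: "h \<in> carrier G" using g h by auto
    have "g \<otimes> h \<otimes> a = g \<otimes> (h \<otimes> a)" using gG hG a by (simp add: m_assoc)
    also have "h \<otimes> a = a \<otimes> h" using h by simp
    also have "g \<otimes> (a \<otimes> h) = g \<otimes> a \<otimes> h" using gG hG a by (simp add: m_assoc)
    also have "g \<otimes> a = a \<otimes> g" using g by simp
    also have "a \<otimes> g \<otimes> h = a \<otimes> (g \<otimes> h)" using gG hG a by (simp add: m_assoc)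
    finally show "g \<otimes> h \<in> {g \<in> carrier G. g \<otimes> a = a \<otimes> g}" using gG hG by simp
  qed auto
  then have "card (rcosets ?C) * card ?C = Coset.order G" by (rule lagrange)
  then show ?thesis unfolding conj_count_def using dvd_triv_right[of "card ?C" "card (rcosets ?C)"] by simp
qed

section \<open>Columns that differ in one character\<close>

text \<open>
  The difference \<open>f\<close> of the two sides is a class function. Its pairing with an irreducible \<open>\<psi>\<close> is
  \<open>|G| (\<psi> a - \<psi> b)\<close> from the left side minus \<open>(\<chi> a - \<chi> b)\<close> times the pairing of \<open>\<psi>\<close> with \<open>\<chi>\<close>. For
  \<open>\<psi> \<noteq> \<chi>\<close> both terms vanish, and for \<open>\<psi> = \<chi>\<close> they cancel by the norm relation; so \<open>f = 0\<close> by
  completeness.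
\<close>

lemma columns_differing_in_one_character:
  assumes a: "a \<in> carrier G" and b: "b \<in> carrier G" and \<chi>: "\<chi> \<in> Irr G"
    and others: "\<And>\<psi>. \<psi> \<in> Irr G \<Longrightarrow> \<psi> \<noteq> \<chi> \<Longrightarrow> \<psi> a = \<psi> b" and x: "x \<in> carrier G"
  shows "of_nat (conj_count a x) - of_nat (conj_count b x) = (\<chi> a - \<chi> b) * \<chi> (inv x)"
proof -
  define f where "f = (\<lambda>x. of_nat (conj_count a x) - of_nat (conj_count b x) - (\<chi> a - \<chi> b) * \<chi> (inv x))"
  have "f x = 0"
  proof (rule class_function_orthogonal_to_irreps_eq_zero[OF _ _ x])
    show "class_function f"
      unfolding class_function_def
    proof (intro ballI)
      fix g h assume g: "g \<in> carrier G" and h: "h \<in> carrier G"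
      have "inv (h \<otimes> g \<otimes> inv h) = h \<otimes> inv g \<otimes> inv h"
        using g h by (simp add: inv_mult_group m_assoc)
      then show "f (h \<otimes> g \<otimes> inv h) = f g"
        using Irr_class_function[OF \<chi>] g h a b
        unfolding f_def class_function_def by (simp add: conj_count_class_function)
    qed
    fix n \<rho> assume \<rho>: "is_irrep G n \<rho>"
    define \<psi> where "\<psi> = (\<lambda>g\<in>carrier G. mat_trace (\<rho> g))"
    have \<psi>: "\<psi> \<in> Irr G" unfolding \<psi>_def by (rule irrep_character_in_Irr[OF \<rho>])
    note cf = Irr_class_function[OF \<psi>]
    have "(\<Sum>g\<in>carrier G. f g * mat_trace (\<rho> g)) = (\<Sum>g\<in>carrier G. f g * \<psi> g)"
      by (simp add: \<psi>_def)
    also have "\<dots> = (\<Sum>g\<in>carrier G. of_nat (conj_count a g) * \<psi> g) - (\<Sum>g\<in>carrier G. of_nat (conj_count b g) * \<psi> g)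
        - (\<chi> a - \<chi> b) * (\<Sum>g\<in>carrier G. \<psi> g * \<chi> (inv g))"
      unfolding f_def by (simp add: sum_subtractf[symmetric] sum_distrib_left algebra_simps)
    also have "\<dots> = of_nat (Coset.order G) * (\<psi> a - \<psi> b) - (\<chi> a - \<chi> b) * (\<Sum>g\<in>carrier G. \<psi> g * \<chi> (inv g))"
      unfolding sum_conj_count[OF a cf] sum_conj_count[OF b cf] by (simp add: algebra_simps)
    also have "\<dots> = 0"
    proof (cases "\<psi> = \<chi>")
      case True
      then show ?thesis using Irr_norm[OF \<chi>] by (simp add: algebra_simps)
    next
      case False
      then show ?thesis using Irr_orthogonal[OF \<psi> \<chi> False] others[OF \<psi> False] by simp
    qed
    finally show "(\<Sum>g\<in>carrier G. f g * mat_trace (\<rho> g)) = 0" .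
  qed
  then show ?thesis unfolding f_def by simp
qed

text \<open>
  Evaluating the hypothesis at \<open>1\<close> and at \<open>b\<close> gives two equations for \<open>c = \<chi> 1 - \<chi> b\<close>. The second
  shows that \<open>\<chi> (inv b)\<close>, and therefore its conjugate \<open>\<chi> b\<close>, is the rational number \<open>- s n / |G|\<close>;
  eliminating \<open>c\<close> leaves \<open>|G|\<^sup>2 = n\<^sup>2 (|G| + s)\<close>, in which all factors are powers of \<open>r\<close>.
\<close>

lemma central_type_of_conj_count:
  assumes r: "Factorial_Ring.prime r" and k: "Coset.order G = r ^ k"
    and b: "b \<in> carrier G" "b \<noteq> \<one>" and \<chi>: "\<chi> \<in> Irr G"
    and key: "\<And>x. x \<in> carrier G \<Longrightarrow> of_nat (conj_count \<one> x) - of_nat (conj_count b x) = (\<chi> \<one> - \<chi> b) * \<chi> (inv x)"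
  shows "r = 2 \<and> card (group_center G) = 2 \<and> of_nat (card (rcosets (group_center G))) = (\<chi> \<one>)\<^sup>2"
proof -
  let ?N = "Coset.order G"
  define s where "s = conj_count b b"
  define c where "c = \<chi> \<one> - \<chi> b"
  obtain n where n: "0 < n" "\<chi> \<one> = of_nat n" by (rule Irr_degree[OF \<chi>])
  have N0: "?N \<noteq> 0" unfolding Coset.order_def by auto
  have "conj_count b \<one> = 0" using b conj_eq_one_iff by (simp add: conj_count_eq_zero_iff)
  then have e1: "of_nat ?N = c * of_nat n"
    using key[of \<one>] n by (simp add: conj_count_one c_def)
  then have c0: "c \<noteq> 0" using N0 by auto
  have e2: "- of_nat s = c * \<chi> (inv b)"
    using key[OF b(1)] b by (simp add: conj_count_one c_def s_def)
  have ceq: "c = of_nat ?N / of_nat n" using e1 n(1) by (simp add: field_simps)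
  have "\<chi> (inv b) = - (of_nat s * of_nat n / of_nat ?N)"
    using e2 N0 n(1) unfolding ceq by (simp add: field_simps)
  then have "\<chi> b = - (of_nat s * of_nat n / of_nat ?N)"
    using Irr_inv[OF \<chi> b(1)] by (metis complex_cnj_cnj complex_cnj_divide complex_cnj_minus complex_cnj_mult complex_cnj_of_nat)
  then have "of_nat ?N / of_nat n = of_nat n + of_nat s * of_nat n / (of_nat ?N :: complex)"
    using ceq n(2) unfolding c_def by simp
  then have "of_nat (?N * ?N) = (of_nat (n * n * (?N + s)) :: complex)"
    using n(1) N0 by (simp add: field_simps)
  then have NN: "?N * ?N = n * n * (?N + s)" by (simp only: of_nat_eq_iff)
  have "s dvd ?N" unfolding s_def by (rule conj_count_self_dvd_order[OF b(1)])
  then obtain i where i: "i \<le> k" "s = r ^ i" unfolding k using divides_primepow_nat[OF r] by blast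
  have "?N + s dvd ?N * ?N" unfolding NN by simp
  then have "?N + s dvd r ^ (k + k)" by (simp only: k power_add)
  then obtain j where "?N + s = r ^ j" using divides_primepow_nat[OF r] by blast
  then have ik: "i = k" and r2: "r = 2" using prime_power_sum_eq_prime_power[OF r i(1)] unfolding k i(2) by auto
  have sN: "s = ?N" using i ik k by simp
  have "?N * ?N = ?N * (2 * n\<^sup>2)" using NN unfolding sN by (simp add: power2_eq_square algebra_simps)
  then have N2: "?N = 2 * n\<^sup>2" using N0 by simp
  \<comment> \<open>The centralizer of \<open>b\<close> has order \<open>s = |G|\<close>.\<close>
  have "{g \<in> carrier G. g \<otimes> b \<otimes> inv g = b} = carrier G"
    by (rule card_subset_eq) (use sN in \<open>auto simp: s_def conj_count_def Coset.order_def\<close>)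
  then have fix_b: "g \<otimes> b \<otimes> inv g = b" if "g \<in> carrier G" for g using that by blast
  have bZ: "b \<in> group_center G"
    unfolding group_center_def using b fix_b by (auto, metis inv_solve_right m_closed)
  have "group_center G = {\<one>, inv b}"
  proof
    show "{\<one>, inv b} \<subseteq> group_center G"
      using subgroup.one_closed[OF group_center_subgroup] subgroup.m_inv_closed[OF group_center_subgroup bZ] by simp
    show "group_center G \<subseteq> {\<one>, inv b}"
    proof
      fix z assume z: "z \<in> group_center G"
      have zG: "z \<in> carrier G" using z unfolding group_center_def by simp
      obtain d where d: "\<chi> z = d * \<chi> \<one>" "d \<noteq> 0" by (rule Irr_central[OF \<chi> z])
      \<comment> \<open>\<open>\<chi>\<close> has no zeros on the center, while the hypothesis makes it vanish outside \<open>1\<close> and \<open>inv b\<close>.\<close>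
      have "\<chi> z \<noteq> 0" using d n by simp
      then have "conj_count \<one> (inv z) \<noteq> conj_count b (inv z)"
        using key[of "inv z"] zG c0 unfolding c_def by auto
      then have "conj_count \<one> (inv z) \<noteq> 0 \<or> conj_count b (inv z) \<noteq> 0" by auto
      then have "inv z = \<one> \<or> inv z = b"
        using conj_count_one[of "inv z"] zG fix_b by (auto simp: conj_count_eq_zero_iff split: if_splits)
      then show "z \<in> {\<one>, inv b}" using zG by (metis insertCI inv_inv inv_one)
    qed
  qed
  moreover have "inv b \<noteq> \<one>" using b by (metis inv_inv inv_one)
  ultimately have Z2: "card (group_center G) = 2" by simp
  have "card (rcosets (group_center G)) * 2 = 2 * n\<^sup>2"
    using lagrange[OF group_center_subgroup] unfolding Z2 N2 .
  then have "card (rcosets (group_center G)) = n\<^sup>2" by simp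
  then show ?thesis using r2 Z2 n(2) by simp
qed

text \<open>
  Since \<open>\<chi> 1 \<noteq> 0\<close>, the identity is conjugate to \<open>a\<close> or to \<open>b\<close>, hence equal to one of them. The
  situation is symmetric in \<open>a\<close> and \<open>b\<close>.
\<close>

lemma CD1_imp_central_type:
  assumes r: "Factorial_Ring.prime r" and k: "Coset.order G = r ^ k" and CD1: "CD1_group G"
  shows "r = 2 \<and> card (group_center G) = 2 \<and> central_type G"
proof -
  obtain a b \<chi> where a: "a \<in> carrier G" and b: "b \<in> carrier G" and nc: "\<not> conjugate_in G a b"
    and \<chi>: "\<chi> \<in> Irr G" and ab: "\<chi> a \<noteq> \<chi> b" and others: "\<And>\<psi>. \<psi> \<in> Irr G \<Longrightarrow> \<psi> \<noteq> \<chi> \<Longrightarrow> \<psi> a = \<psi> b"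
    using CD1 unfolding CD1_group_def by blast
  note key = columns_differing_in_one_character[OF a b \<chi> others]
  note key' = columns_differing_in_one_character[OF b a \<chi> others[symmetric]]
  obtain n where n: "0 < n" "\<chi> \<one> = of_nat n" by (rule Irr_degree[OF \<chi>])
  have "conj_count a \<one> \<noteq> conj_count b \<one>" using key[of \<one>] ab n by auto
  then have "conj_count a \<one> \<noteq> 0 \<or> conj_count b \<one> \<noteq> 0" by auto
  then have "a = \<one> \<or> b = \<one>" using conj_eq_one_iff a b by (auto simp: conj_count_eq_zero_iff)
  then have "r = 2 \<and> card (group_center G) = 2 \<and> of_nat (card (rcosets (group_center G))) = (\<chi> \<one>)\<^sup>2"
  proof
    assume "a = \<one>"
    moreover have "b \<noteq> \<one>" using ab \<open>a = \<one>\<close> by auto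
    ultimately show ?thesis using central_type_of_conj_count[OF r k b _ \<chi>] key by simp
  next
    assume "b = \<one>"
    moreover have "a \<noteq> \<one>" using ab \<open>b = \<one>\<close> by auto
    ultimately show ?thesis using central_type_of_conj_count[OF r k a _ \<chi>] key' by simp
  qed
  then show ?thesis unfolding central_type_def using \<chi> is_group by auto
qed

text \<open>
  The center has two elements, on which every irreducible character takes its degree or minus its degree.
  For the given \<open>\<chi>\<close> they already account for the whole norm \<open>|G| = 2 n\<^sup>2\<close>, so \<open>\<chi>\<close> is supported on the
  center and every orthogonality relation involving \<open>\<chi>\<close> has only two terms.
\<close>

lemma central_type_imp_CD1:
  assumes N: "2 < Coset.order G" and Z2: "card (group_center G) = 2" and ct: "central_type G"
  shows "CD1_group G"
proof -
  obtain \<chi> where \<chi>: "\<chi> \<in> Irr G" and deg: "of_nat (card (rcosets (group_center G))) = (\<chi> \<one>)\<^sup>2"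
    using ct unfolding central_type_def by blast
  obtain n where n: "0 < n" "\<chi> \<one> = of_nat n" by (rule Irr_degree[OF \<chi>])
  have "of_nat (card (rcosets (group_center G))) = (of_nat (n\<^sup>2) :: complex)" using deg n by simp
  then have "card (rcosets (group_center G)) = n\<^sup>2" by (simp only: of_nat_eq_iff)
  then have order: "Coset.order G = 2 * n\<^sup>2" using lagrange[OF group_center_subgroup] Z2 by simp
  have one_Z: "\<one> \<in> group_center G" using subgroup.one_closed[OF group_center_subgroup] .
  obtain x y where xy: "group_center G = {x, y}" "x \<noteq> y" using Z2 by (auto simp: card_2_iff)
  define z where "z = (if x = \<one> then y else x)"
  have Z: "group_center G = {\<one>, z}" and z1: "z \<noteq> \<one>"
    using xy one_Z unfolding z_def by auto
  have zZ: "z \<in> group_center G" using Z by simp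
  have zG: "z \<in> carrier G" using zZ unfolding group_center_def by simp
  have "z \<otimes> z \<in> {\<one>, z}" using subgroup.m_closed[OF group_center_subgroup zZ zZ] Z by simp
  then have zz: "z \<otimes> z = \<one>" using z1 zG by auto
  then have inv_z: "inv z = z" using inv_equality zG by blast
  have sign: "\<psi> z = \<psi> \<one> \<or> \<psi> z = - \<psi> \<one>" if \<psi>: "\<psi> \<in> Irr G" for \<psi>
  proof -
    obtain c where "\<psi> z = c * \<psi> \<one>" "c * c = 1" using Irr_central[OF \<psi> zZ] zz by metis
    then show ?thesis by (auto simp: square_eq_1_iff)
  qed
  have vanish: "\<chi> g = 0" if g: "g \<in> carrier G - {\<one>, z}" for g
  proof -
    have norm_z: "(cmod (\<chi> z))\<^sup>2 = real (n\<^sup>2)" using sign[OF \<chi>] n by (auto simp: norm_power)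
    have norm_1: "(cmod (\<chi> \<one>))\<^sup>2 = real (n\<^sup>2)" using n by simp
    have "of_real (\<Sum>g\<in>carrier G. (cmod (\<chi> g))\<^sup>2) = (\<Sum>g\<in>carrier G. \<chi> g * \<chi> (inv g))"
      unfolding of_real_sum by (intro sum.cong refl) (simp add: Irr_inv[OF \<chi>] complex_norm_square del: of_real_power)
    also have "\<dots> = of_real (real (Coset.order G))" unfolding Irr_norm[OF \<chi>] by simp
    finally have "(\<Sum>g\<in>carrier G. (cmod (\<chi> g))\<^sup>2) = real (2 * n\<^sup>2)" unfolding of_real_eq_iff order .
    also have "(\<Sum>g\<in>carrier G. (cmod (\<chi> g))\<^sup>2) =
        (\<Sum>g\<in>carrier G - {\<one>, z}. (cmod (\<chi> g))\<^sup>2) + (\<Sum>g\<in>{\<one>, z}. (cmod (\<chi> g))\<^sup>2)"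
      by (rule sum.subset_diff) (use zG in auto)
    also have "(\<Sum>g\<in>{\<one>, z}. (cmod (\<chi> g))\<^sup>2) = real (2 * n\<^sup>2)" using z1 norm_z norm_1 by simp
    finally have "(\<Sum>g\<in>carrier G - {\<one>, z}. (cmod (\<chi> g))\<^sup>2) = 0" by simp
    then have "\<forall>g\<in>carrier G - {\<one>, z}. (cmod (\<chi> g))\<^sup>2 = 0" by (subst (asm) sum_nonneg_eq_0_iff) auto
    then show ?thesis using g by simp
  qed
  have inner: "(\<Sum>g\<in>carrier G. \<chi> g * \<psi> (inv g)) = \<chi> \<one> * \<psi> \<one> + \<chi> z * \<psi> z" for \<psi>
  proof -
    have "(\<Sum>g\<in>carrier G. \<chi> g * \<psi> (inv g)) = (\<Sum>g\<in>{\<one>, z}. \<chi> g * \<psi> (inv g))"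
      by (rule sum.mono_neutral_right) (use zG vanish in auto)
    then show ?thesis using z1 inv_z by simp
  qed
  \<comment> \<open>Otherwise \<open>\<chi>\<close> would not be orthogonal to the trivial character, so it would be trivial; then
    \<open>n = 1\<close> and the group would have order \<open>2\<close>.\<close>
  have \<chi>z: "\<chi> z = - of_nat n"
  proof (rule ccontr)
    assume "\<chi> z \<noteq> - of_nat n"
    then have "\<chi> z = of_nat n" using sign[OF \<chi>] n by auto
    then have "\<chi> \<one> * (\<lambda>g\<in>carrier G. 1) \<one> + \<chi> z * (\<lambda>g\<in>carrier G. 1) z \<noteq> 0"
      using n zG by simp
    then have "\<chi> = (\<lambda>g\<in>carrier G. 1)"
      using Irr_orthogonal[OF \<chi> trivial_character_in_Irr] inner by metis
    then have "n = 1" using n by simp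
    then show False using order N by simp
  qed
  have others: "\<psi> \<one> = \<psi> z" if "\<psi> \<in> Irr G" "\<psi> \<noteq> \<chi>" for \<psi>
  proof -
    have "\<chi> \<one> * \<psi> \<one> + \<chi> z * \<psi> z = 0" using Irr_orthogonal[OF \<chi> that(1)] that(2) inner by metis
    then show ?thesis using n \<chi>z by (simp add: algebra_simps)
  qed
  have "\<not> conjugate_in G \<one> z" unfolding conjugate_in_def using z1 by auto
  moreover have "\<chi> \<one> \<noteq> \<chi> z"
    using n(1) unfolding n(2) \<chi>z eq_neg_iff_add_eq_0 of_nat_add[symmetric] of_nat_eq_0_iff by simp
  ultimately show ?thesis
    unfolding CD1_group_def using is_group finite_carrier N one_closed zG \<chi> others by blast
qed

end

theorem corollary3p5:
  fixes G :: "('a, 'b) monoid_scheme" and r :: nat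
  assumes "finite_p_group r G"
    and "2 < Coset.order G"
  shows "CD1_group G \<longleftrightarrow>
    r = 2 \<and> finite_p_group 2 G \<and> central_type G \<and> card (group_center G) = 2"
proof -
  obtain k where r: "Factorial_Ring.prime r" and G: "group G" "finite (carrier G)"
    and k: "Coset.order G = r ^ k"
    using assms(1) unfolding finite_p_group_def by blast
  interpret finite_group G
    by (intro finite_group.intro finite_group_axioms.intro G)
  show ?thesis
    using CD1_imp_central_type[OF r k] central_type_imp_CD1[OF assms(2)] assms(1) by blast
qed

end
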